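(* Let $d\in\mathbb{N}$, $\alpha>0$, and let $(\sigma,A)$ be an $\alpha$-Hölder continuous $\mathrm{GL}(d,\mathbb{R})$ cocycle over a transitive subshift of finite type $\sigma:\Sigma_H\to\Sigma_H$ with positive topological entropy. Suppose $(\sigma,A^{(n)})$, $n\in\mathbb{N}$, is a sequence of continuous $\mathrm{GL}(d,\mathbb{R})$ cocycles with $d_{\mathcal{C}^0}(A,A^{(n)})\to0$. If for some $\kappa>0$ $$h_{\mathrm{top}}(\sigma|_{\mathrm{B}(A^{(n)},\kappa)})\to h_{\mathrm{top}}(\sigma|_{\Sigma_H}),$$ then $(\sigma,A)$ is continuously conjugate to an isometric cocycle. In particular, if $h_{\mathrm{top}}(\sigma|_{\mathrm{B}(A,\kappa)})=h_{\mathrm{top}}(\sigma|_{\Sigma_H})$ for some $\kappa>0$, then $(\sigma,A)$ is continuously conjugate to an isometric cocycle.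
   Context: Alphabet $\mathcal{A}=\{1,\dots,N\}$, $H$ an $N\times N$ $\{0,1\}$-matrix; $\Sigma_H$ is the set of $(x_i)_{i\in\mathbb{Z}}\in\mathcal{A}^{\mathbb{Z}}$ with $H_{x_i,x_{i+1}}=1$ for all $i$, metric $\mathrm{dist}(x,y)=2^{-\min\{|i|:x_i\ne y_i\}}$, $\sigma$ the left shift; transitive means a dense forward orbit. A $\mathrm{GL}(d,\mathbb{R})$ cocycle is a continuous map $A:\Sigma_H\to\mathrm{GL}(d,\mathbb{R})$, with $A_0=\mathrm{Id}$, $A_n(x)=A(\sigma^{n-1}x)\cdots A(x)$, $A_{-n}(x)=(A_n(\sigma^{-n}x))^{-1}$ for $n\ge1$. $\|\cdot\|$ is the operator norm; $\alpha$-Hölder means $\|A(x)-A(y)\|\le C\,\mathrm{dist}(x,y)^\alpha$; $d_{\mathcal{C}^0}(A,B)=\sup_x\|A(x)-B(x)\|$. $\mathrm{B}(A,\kappa)=\{x\in\Sigma_H:\|A_n(x)^{\pm1}\|\le\kappa\text{ for all }n\in\mathbb{Z}\}$, a closed $\sigma$-invariant set; $h_{\mathrm{top}}$ is topological entropy. $(\sigma,A)$ is continuously conjugate to an isometric cocycle if there is a continuous $P:\Sigma_H\to\mathrm{GL}(d,\mathbb{R})$ with $P(\sigma(x))^{-1}A(x)P(x)\in\mathrm{O}(d)$ for all $x$. *)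

theory Defs
  imports "HOL-Analysis.Analysis" "HOL-Library.Liminf_Limsup" "HOL-Library.Extended_Real"
begin

type_synonym seq = "int \<Rightarrow> nat"

text \<open>The subshift of finite type with alphabet 1..N and transition matrix H
  (a 0-1 matrix, encoded as a boolean relation: H a b means H_{a,b} = 1).\<close>
definition SFT :: "nat \<Rightarrow> (nat \<Rightarrow> nat \<Rightarrow> bool) \<Rightarrow> seq set" where
  "SFT N H = {x. \<forall>i. x i \<in> {1..N} \<and> H (x i) (x (i + 1))}"

definition sdist :: "seq \<Rightarrow> seq \<Rightarrow> real" where
  "sdist x y = (if x = y then 0 else (1/2) ^ (LEAST m. \<exists>i. nat \<bar>i\<bar> = m \<and> x i \<noteq> y i))"

definition shift :: "seq \<Rightarrow> seq" where
  "shift x = (\<lambda>i. x (i + 1))"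

definition shiftn :: "int \<Rightarrow> seq \<Rightarrow> seq" where
  "shiftn k x = (\<lambda>i. x (i + k))"

definition transitive_shift :: "seq set \<Rightarrow> bool" where
  "transitive_shift X \<longleftrightarrow>
     (\<exists>x\<in>X. \<forall>y\<in>X. \<forall>e>0. \<exists>n::nat. sdist (shiftn (int n) x) y < e)"

text \<open>Topological entropy of the shift restricted to X (Bowen's definition via
  (n,eps)-separated sets w.r.t. d_n(x,y) = max_{0<=k<n} dist(sigma^k x, sigma^k y)).\<close>
definition sep_sets :: "nat \<Rightarrow> real \<Rightarrow> seq set \<Rightarrow> seq set set" where
  "sep_sets n e X = {S. finite S \<and> S \<subseteq> X \<and>
     (\<forall>x\<in>S. \<forall>y\<in>S. x \<noteq> y \<longrightarrow> (\<exists>k<n. sdist (shiftn (int k) x) (shiftn (int k) y) > e))}"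

definition sep_num :: "nat \<Rightarrow> real \<Rightarrow> seq set \<Rightarrow> enat" where
  "sep_num n e X = Sup ((\<lambda>S. enat (card S)) ` sep_sets n e X)"

definition sep_rate :: "nat \<Rightarrow> real \<Rightarrow> seq set \<Rightarrow> ereal" where
  "sep_rate n e X = (case sep_num n e X of
      \<infinity> \<Rightarrow> \<infinity>
    | enat m \<Rightarrow> (if m = 0 then - \<infinity> else ereal (ln (real m) / real n)))"

definition htop :: "seq set \<Rightarrow> ereal" where
  "htop X = (SUP e\<in>{0<..}. limsup (\<lambda>n. sep_rate n e X))"

definition mnorm :: "real^'d^'d \<Rightarrow> real" where
  "mnorm M = onorm (\<lambda>v. M *v v)"

definition scont :: "seq set \<Rightarrow> (seq \<Rightarrow> real^'d^'d) \<Rightarrow> bool" where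
  "scont X f \<longleftrightarrow> (\<forall>x\<in>X. \<forall>e>0. \<exists>\<delta>>0. \<forall>y\<in>X. sdist x y < \<delta> \<longrightarrow> mnorm (f y - f x) < e)"

definition GL_cocycle :: "seq set \<Rightarrow> (seq \<Rightarrow> real^'d^'d) \<Rightarrow> bool" where
  "GL_cocycle X A \<longleftrightarrow> scont X A \<and> (\<forall>x\<in>X. invertible (A x))"

definition holder :: "seq set \<Rightarrow> real \<Rightarrow> (seq \<Rightarrow> real^'d^'d) \<Rightarrow> bool" where
  "holder X \<alpha> A \<longleftrightarrow> (\<exists>C. \<forall>x\<in>X. \<forall>y\<in>X. mnorm (A x - A y) \<le> C * sdist x y powr \<alpha>)"

fun cocp :: "(seq \<Rightarrow> real^'d^'d) \<Rightarrow> nat \<Rightarrow> seq \<Rightarrow> real^'d^'d" where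
  "cocp A 0 x = mat 1"
| "cocp A (Suc n) x = A (shiftn (int n) x) ** cocp A n x"

definition coc :: "(seq \<Rightarrow> real^'d^'d) \<Rightarrow> int \<Rightarrow> seq \<Rightarrow> real^'d^'d" where
  "coc A k x = (if 0 \<le> k then cocp A (nat k) x else matrix_inv (cocp A (nat (- k)) (shiftn k x)))"

definition Bset :: "seq set \<Rightarrow> (seq \<Rightarrow> real^'d^'d) \<Rightarrow> real \<Rightarrow> seq set" where
  "Bset X A \<kappa> = {x\<in>X. \<forall>n::int. mnorm (coc A n x) \<le> \<kappa> \<and> mnorm (matrix_inv (coc A n x)) \<le> \<kappa>}"

definition dC0 :: "seq set \<Rightarrow> (seq \<Rightarrow> real^'d^'d) \<Rightarrow> (seq \<Rightarrow> real^'d^'d) \<Rightarrow> real" where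
  "dC0 X A B = (SUP x\<in>X. mnorm (A x - B x))"

definition conj_isometric :: "seq set \<Rightarrow> (seq \<Rightarrow> real^'d^'d) \<Rightarrow> bool" where
  "conj_isometric X A \<longleftrightarrow> (\<exists>P. GL_cocycle X P \<and>
      (\<forall>x\<in>X. orthogonal_matrix (matrix_inv (P (shift x)) ** A x ** P x)))"

end

theory Submission
  imports Defs "HOL-Library.Sublist"
begin

text \<open>
  A transitive subshift of finite type has an entropy gap: if a set of points avoids a fixed word
  \<open>w\<close>, its entropy is bounded by a constant below the full entropy.  Indeed all letters have loops
  of one common length \<open>l\<close> that contain \<open>w\<close>; inserting them at an arbitrary set of multiples of
  \<open>l\<close> into a \<open>w\<close>-avoiding word is injective, since the first occurrence of \<open>w\<close> reveals the first
  insertion, so every avoiding word of length \<open>n\<close> yields exponentially many words.  Hence the sets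
  of bounded points of the approximating cocycles meet, after a forward shift, every cylinder, and
  in the limit \<open>A\<close> itself has uniformly bounded products \<open>A\<^sub>n(x)\<^sup>\<plusminus>\<^sup>1\<close>.  The shift costs a factor:
  the sets \<open>B(A, \<kappa>)\<close> need not be invariant, but their shifts lie in \<open>B(A, \<kappa>\<^sup>2)\<close>.

  For a bounded Hoelder cocycle let \<open>T(x, y)\<close> be the set of limits of \<open>A\<^sub>n(z)\<close> with \<open>z\<close> tending
  to \<open>x\<close> and \<open>\<sigma>\<^sup>n z\<close> tending to \<open>y\<close>.  These sets are nonempty by transitivity, they have closed graph,
  and \<open>T(y, w) T(x, y) \<subseteq> T(x, w)\<close> because orbit segments can be glued with a small error.  The
  bounded semigroup \<open>T(x\<^sub>0, x\<^sub>0)\<close> preserves a positive definite form \<open>Q\<^sub>0\<close>.  Transporting \<open>Q\<^sub>0\<close> by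
  any element of \<open>T(x\<^sub>0, x)\<close> gives a well-defined continuous \<open>A\<close>-invariant field of forms, and its
  positive square root is the conjugacy.
\<close>

subsection \<open>Sequences and cylinders\<close>

text \<open>Stands in for metric balls: \<open>sdist\<close> below \<open>(1/2) ^ K\<close> forces
  agreement on this window, which in turn forces \<open>sdist\<close> at most
  \<open>(1/2) ^ Suc K\<close>.\<close>

definition agree :: "nat \<Rightarrow> seq \<Rightarrow> seq \<Rightarrow> bool" where
  "agree K x y \<longleftrightarrow> (\<forall>i. \<bar>i\<bar> \<le> int K \<longrightarrow> x i = y i)"

definition word :: "seq \<Rightarrow> int \<Rightarrow> nat \<Rightarrow> nat list" where
  "word x p n = map (\<lambda>i. x (p + int i)) [0..<n]"

lemma agree_refl [simp]: "agree K x x"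
  by (simp add: agree_def)

lemma agree_sym: "agree K x y \<Longrightarrow> agree K y x"
  by (simp add: agree_def)

lemma agree_trans: "agree K x y \<Longrightarrow> agree K y z \<Longrightarrow> agree K x z"
  by (simp add: agree_def)

lemma agree_mono: "agree K x y \<Longrightarrow> k \<le> K \<Longrightarrow> agree k x y"
  by (simp add: agree_def)

lemma agree_shiftn: "agree (K + m) x y \<Longrightarrow> agree K (shiftn (int m) x) (shiftn (int m) y)"
  by (auto simp: agree_def shiftn_def)

lemma shiftn_add: "shiftn a (shiftn b x) = shiftn (a + b) x"
  by (simp add: shiftn_def add.assoc)

lemma shiftn_0 [simp]: "shiftn 0 x = x"
  by (simp add: shiftn_def)

lemma shiftn_1: "shiftn 1 x = shift x"
  by (simp add: shiftn_def shift_def)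

lemma agree_imp_sdist_le:
  assumes "agree K x y"
  shows "sdist x y \<le> (1/2) ^ Suc K"
proof (cases "x = y")
  case False
  then obtain i where i: "x i \<noteq> y i" by auto
  define m where "m = (LEAST m. \<exists>i. nat \<bar>i\<bar> = m \<and> x i \<noteq> y i)"
  have "\<exists>i. nat \<bar>i\<bar> = m \<and> x i \<noteq> y i"
    unfolding m_def by (rule LeastI[of _ "nat \<bar>i\<bar>"]) (use i in auto)
  then have "Suc K \<le> m" using assms unfolding agree_def by (metis not_less_eq_eq nat_le_iff)
  then have "(1/2::real) ^ m \<le> (1/2) ^ Suc K" by (intro power_decreasing) auto
  then show ?thesis using False by (simp add: sdist_def m_def)
qed (simp add: sdist_def)

lemma sdist_less_imp_agree:
  assumes "sdist x y < (1/2) ^ K"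
  shows "agree K x y"
  unfolding agree_def
proof (intro allI impI, rule ccontr)
  fix i assume i: "\<bar>i\<bar> \<le> int K" "x i \<noteq> y i"
  define m where "m = (LEAST m. \<exists>i. nat \<bar>i\<bar> = m \<and> x i \<noteq> y i)"
  have "m \<le> nat \<bar>i\<bar>" unfolding m_def by (rule Least_le) (use i in auto)
  then have "m \<le> K" using i by linarith
  then have "(1/2::real) ^ K \<le> (1/2) ^ m" by (intro power_decreasing) auto
  moreover have "x \<noteq> y" using i by auto
  ultimately show False using assms by (simp add: sdist_def m_def)
qed

lemma sdist_nonneg: "sdist x y \<ge> 0"
  by (simp add: sdist_def)

lemma half_power_less: "e > 0 \<Longrightarrow> \<exists>k. (1/2::real) ^ k < e"
  by (simp add: real_arch_pow_inv)

lemma SFT_shiftn: "x \<in> SFT N H \<Longrightarrow> shiftn k x \<in> SFT N H"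
  unfolding SFT_def shiftn_def by (auto simp: algebra_simps) (metis add.assoc add.commute)

lemma length_word [simp]: "length (word x p n) = n"
  by (simp add: word_def)

lemma nth_word [simp]: "i < n \<Longrightarrow> word x p n ! i = x (p + int i)"
  by (simp add: word_def)

lemma word_append: "word x p (m + n) = word x p m @ word x (p + int m) n"
  by (rule nth_equalityI) (auto simp: nth_append algebra_simps)

lemma word_eq_iff: "word x p n = word y q n \<longleftrightarrow> (\<forall>i<n. x (p + int i) = y (q + int i))"
  by (auto simp: list_eq_iff_nth_eq)

lemma agree_iff_word: "agree K x y \<longleftrightarrow> word x (- int K) (2 * K + 1) = word y (- int K) (2 * K + 1)"
  unfolding word_eq_iff agree_def
proof (intro iffI allI impI)
  fix i assume *: "\<forall>i<2 * K + 1. x (- int K + int i) = y (- int K + int i)" and "\<bar>i\<bar> \<le> int K"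
  then have "nat (i + int K) < 2 * K + 1" "- int K + int (nat (i + int K)) = i" by auto
  then show "x i = y i" using * by metis
qed auto

text \<open>A dense forward orbit might visit a cylinder only early, while loops and orbit segments
  have to be read off in a prescribed order. Positive returns of \<open>x\<close> to itself are
  composed into late ones, and any visit is then repeated late.\<close>

lemma transitive_recurrent:
  assumes "transitive_shift (SFT N H)"
  obtains x where "x \<in> SFT N H"
    "\<And>y K n0. y \<in> SFT N H \<Longrightarrow> \<exists>n\<ge>n0. agree K (shiftn (int n) x) y"
proof -
  obtain x where x: "x \<in> SFT N H"
    and dense: "\<forall>y\<in>SFT N H. \<forall>e>0. \<exists>n::nat. sdist (shiftn (int n) x) y < e"
    using assms unfolding transitive_shift_def by auto
  have dense': "\<exists>n. agree K (shiftn (int n) x) y" if y: "y \<in> SFT N H" for y K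
  proof -
    obtain n::nat where "sdist (shiftn (int n) x) y < (1/2)^K"
      using dense[rule_format, OF y, of "(1/2)^K"] by auto
    then show ?thesis using sdist_less_imp_agree by blast
  qed
  \<comment> \<open>Approximating the backward shift of \<open>x\<close> by forward shifts forces returns at positive times.\<close>
  have ret: "\<exists>n\<ge>1. agree K (shiftn (int n) x) x" for K
  proof -
    obtain n where "agree (K+1) (shiftn (int n) x) (shiftn (-1) x)"
      using dense' SFT_shiftn[OF x] by blast
    then have "agree K (shiftn 1 (shiftn (int n) x)) (shiftn 1 (shiftn (-1) x))"
      using agree_shiftn[of K 1] by simp
    then show ?thesis by (intro exI[of _ "Suc n"]) (simp add: shiftn_add)
  qed
  have rec: "\<exists>n\<ge>n0. agree K (shiftn (int n) x) x" for n0 K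
  proof (induction n0)
    case (Suc n0)
    then obtain n1 where n1: "n1 \<ge> n0" "agree K (shiftn (int n1) x) x" by auto
    \<comment> \<open>The extra \<open>n1\<close> letters of agreement are used up when the window
      is moved by \<open>n1\<close>.\<close>
    obtain n2 where n2: "n2 \<ge> 1" "agree (K + n1) (shiftn (int n2) x) x" using ret by blast
    have "agree K (shiftn (int n1) (shiftn (int n2) x)) (shiftn (int n1) x)"
      using n2 agree_shiftn by blast
    then have "agree K (shiftn (int (n1 + n2)) x) x"
      using n1 agree_trans by (fastforce simp: shiftn_add)
    then show ?case using n1 n2 by (intro exI[of _ "n1+n2"]) auto
  next
    case 0
    show ?case using ret by blast
  qed
  have "\<exists>n\<ge>n0. agree K (shiftn (int n) x) y" if y: "y \<in> SFT N H" for y K n0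
  proof -
    obtain m where m: "agree K (shiftn (int m) x) y" using dense'[OF y] by blast
    obtain n where n: "n \<ge> n0" "agree (K + m) (shiftn (int n) x) x" using rec by blast
    have "agree K (shiftn (int m) (shiftn (int n) x)) (shiftn (int m) x)"
      using n agree_shiftn by blast
    then have "agree K (shiftn (int (m + n)) x) y"
      using m agree_trans by (fastforce simp: shiftn_add)
    then show ?thesis using n by (intro exI[of _ "m+n"]) auto
  qed
  then show thesis using that x by blast
qed

text \<open>The transition rule reads only adjacent letters, so a single shared letter at the seam
  is enough.\<close>

lemma SFT_glue:
  assumes "x \<in> SFT N H" "y \<in> SFT N H" "x n = y 0"
  shows "(\<lambda>i. if i \<le> n then x i else y (i - n)) \<in> SFT N H"
proof -
  have "H (x n) (y 1)" using assms unfolding SFT_def by (metis (mono_tags, lifting) add_0 mem_Collect_eq)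
  moreover have "H (y (i - n)) (y (i + 1 - n))" for i
  proof -
    have "H (y (i - n)) (y (i - n + 1))" using assms(2) by (auto simp: SFT_def)
    then show ?thesis by (simp add: algebra_simps)
  qed
  moreover have "i = n" if "i \<le> n" "\<not> i + 1 \<le> n" for i using that by linarith
  ultimately show ?thesis using assms unfolding SFT_def by fastforce
qed

subsection \<open>Words\<close>

text \<open>Asking each letter to occur in a point of the subshift excludes dead ends, so the
  nonempty legal words are exactly those read off points (\<open>legal_word\<close>,
  \<open>legal_imp_word\<close>).\<close>

definition legal :: "nat \<Rightarrow> (nat \<Rightarrow> nat \<Rightarrow> bool) \<Rightarrow> nat list \<Rightarrow> bool" where
  "legal N H us \<longleftrightarrow> (\<forall>a\<in>set us. \<exists>x\<in>SFT N H. x 0 = a) \<and> successively H us"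

lemma legal_word:
  assumes "x \<in> SFT N H"
  shows "legal N H (word x p n)"
proof -
  have "\<exists>y\<in>SFT N H. y 0 = x (p + int i)" for i
    by (rule bexI[of _ "shiftn (p + int i) x"]) (use assms SFT_shiftn in \<open>auto simp: shiftn_def\<close>)
  moreover have "H (x (p + int i)) (x (p + int (Suc i)))" for i
  proof -
    have "H (x (p + int i)) (x (p + int i + 1))" using assms by (auto simp: SFT_def)
    then show ?thesis by (simp add: algebra_simps)
  qed
  ultimately show ?thesis by (auto simp: legal_def successively_conv_nth word_def)
qed

text \<open>The word grows on the right: the point for the shorter word supplies the past, a point
  with the new letter at 0 supplies the future, and only the transition at the seam is new.\<close>

lemma legal_imp_word:
  assumes "legal N H us" "us \<noteq> []"
  shows "\<exists>x\<in>SFT N H. word x 0 (length us) = us"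
  using assms(2,1)
proof (induction us rule: rev_nonempty_induct)
  case (single a)
  then show ?case by (auto simp: legal_def word_def)
next
  case (snoc a us)
  have "legal N H us" using snoc.prems by (auto simp: legal_def successively_append_iff)
  then obtain x where x: "x \<in> SFT N H" "word x 0 (length us) = us" using snoc.IH by auto
  obtain y where y: "y \<in> SFT N H" "y 0 = a" using snoc.prems by (auto simp: legal_def)
  have last: "last us = x (int (length us) - 1)"
    using x(2) snoc.hyps by (metis last_conv_nth nth_word diff_less length_greater_0_conv
      less_numeral_extra(1) add_0 of_nat_1 of_nat_diff Suc_leI One_nat_def)
  have H: "H (x (int (length us) - 1)) (y 0)"
    using snoc.prems snoc.hyps last y by (auto simp: legal_def successively_append_iff)
  define z where "z = (\<lambda>i. if i < int (length us) then x i else y (i - int (length us)))"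
  have "z i \<in> {1..N} \<and> H (z i) (z (i+1))" for i
  proof (cases "i = int (length us) - 1")
    case True
    then show ?thesis using H x(1) y(1) by (auto simp: z_def SFT_def)
  next
    case False
    have "H (y (i - int (length us))) (y (i - int (length us) + 1))" "H (x i) (x (i+1))"
      using x y by (auto simp: SFT_def)
    then show ?thesis using False x(1) y(1) by (auto simp: z_def SFT_def algebra_simps)
  qed
  then have "z \<in> SFT N H" by (auto simp: SFT_def)
  moreover have "word z 0 (length (us @ [a])) = us @ [a]"
  proof -
    have "word z 0 (length us) = word x 0 (length us)" by (auto simp: word_eq_iff z_def)
    moreover have "word z (int (length us)) 1 = [a]" using y by (simp add: word_def z_def)
    ultimately show ?thesis using x(2) word_append[of z 0 "length us" 1] by simp
  qed
  ultimately show ?case by blast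
qed

definition letters :: "nat \<Rightarrow> (nat \<Rightarrow> nat \<Rightarrow> bool) \<Rightarrow> nat set" where
  "letters N H = (\<lambda>x. x 0) ` SFT N H"

lemma letters_subset: "letters N H \<subseteq> {1..N}"
  by (auto simp: letters_def SFT_def)

lemma legal_iff: "legal N H us \<longleftrightarrow> set us \<subseteq> letters N H \<and> successively H us"
  by (auto simp: legal_def letters_def)

definition lwords :: "nat \<Rightarrow> (nat \<Rightarrow> nat \<Rightarrow> bool) \<Rightarrow> nat \<Rightarrow> nat list set" where
  "lwords N H n = {us. length us = n \<and> legal N H us}"

lemma lwords_subset: "lwords N H n \<subseteq> {us. set us \<subseteq> {1..N} \<and> length us = n}"
  using letters_subset by (fastforce simp: lwords_def legal_iff)

lemma finite_lwords: "finite (lwords N H n)"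
  by (rule finite_subset[OF lwords_subset]) (simp add: finite_lists_length_eq)

lemma card_lwords_le: "card (lwords N H n) \<le> N ^ n"
  using card_mono[OF _ lwords_subset, of N n H] by (simp add: finite_lists_length_eq card_lists_length_eq)

subsection \<open>Inserting loops\<close>

text \<open>The loop is read off a recurrent orbit that visits \<open>a\<close>, then the window of
  \<open>y\<close>, then \<open>a\<close> again. It omits the first \<open>a\<close> and keeps the
  last, so it can be inserted behind any \<open>a\<close> without changing the letter that the
  continuation sees.\<close>

lemma exists_loop:
  assumes "transitive_shift (SFT N H)" "y \<in> SFT N H" "a \<in> letters N H"
  shows "\<exists>g. g \<noteq> [] \<and> last g = a \<and> legal N H (a # g) \<and> sublist (word y (- int K) (2 * K + 1)) g"
proof -
  obtain x where x: "x \<in> SFT N H"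
    and rec: "\<And>y K n0. y \<in> SFT N H \<Longrightarrow> \<exists>n\<ge>n0. agree K (shiftn (int n) x) y"
    using transitive_recurrent[OF assms(1)] by metis
  obtain b where b: "b \<in> SFT N H" "b 0 = a" using assms(3) by (auto simp: letters_def)
  obtain p where p: "agree 0 (shiftn (int p) x) b" using rec[OF b(1)] by blast
  \<comment> \<open>The margins \<open>K + 1\<close> here and for \<open>r\<close> place the whole
    window around \<open>q\<close> strictly between the two visits to \<open>a\<close>.\<close>
  obtain q where q: "q \<ge> p + K + 1" "agree K (shiftn (int q) x) y" using rec[OF assms(2)] by blast
  obtain r where r: "r \<ge> q + K + 1" "agree 0 (shiftn (int r) x) b" using rec[OF b(1)] by blast
  have xp: "x (int p) = a" and xr: "x (int r) = a" using p r b by (auto simp: agree_def shiftn_def)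
  define g where "g = word x (int p + 1) (r - p)"
  have len: "length g = r - p" "r - p > 0" using q r by (auto simp: g_def)
  have "last g = a"
  proof -
    have "last g = g ! (r - p - 1)" using len by (metis last_conv_nth length_0_conv less_not_refl)
    also have "\<dots> = x (int r)" using len unfolding g_def by (subst nth_word) (auto simp: of_nat_diff algebra_simps)
    finally show ?thesis using xr by simp
  qed
  moreover have "a # g = word x (int p) (Suc (r - p))"
    using word_append[of x "int p" 1 "r - p"] xp by (simp add: g_def word_def)
  then have "legal N H (a # g)" using legal_word[OF x] by metis
  moreover have "sublist (word y (- int K) (2 * K + 1)) g"
  proof -
    have w: "word y (- int K) (2 * K + 1) = word x (int q - int K) (2 * K + 1)"
      using q(2) unfolding agree_iff_word word_eq_iff by (auto simp: shiftn_def algebra_simps)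
    define s where "s = q - K - p - 1"
    define t where "t = r - q - K"
    have eq: "r - p = s + ((2 * K + 1) + t)" using q r by (auto simp: s_def t_def)
    have s: "int p + 1 + int s = int q - int K" using q by (auto simp: s_def of_nat_diff)
    have "g = word x (int p + 1) s @ word x (int q - int K) (2 * K + 1) @ word x (int q - int K + int (2 * K + 1)) t"
      unfolding g_def eq by (simp only: word_append[of _ _ s] word_append[of _ _ "2 * K + 1" t] s)
    then show ?thesis unfolding w by simp
  qed
  ultimately show ?thesis using len by (intro exI[of _ g]) auto
qed

lemma legal_append_iff:
  "legal N H (us @ vs) \<longleftrightarrow> legal N H us \<and> legal N H vs \<and> (us = [] \<or> vs = [] \<or> H (last us) (hd vs))"
  by (auto simp: legal_def successively_append_iff)

lemma legal_Cons_iff: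
  "legal N H (a # vs) \<longleftrightarrow> a \<in> letters N H \<and> legal N H vs \<and> (vs = [] \<or> H a (hd vs))"
  by (auto simp: legal_iff successively_Cons)

lemma legal_concat_replicate:
  assumes "legal N H (a # g)" "last (a # g) = a"
  shows "legal N H (a # concat (replicate m g)) \<and> last (a # concat (replicate m g)) = a"
proof (induction m)
  case 0
  then show ?case using assms by (auto simp: legal_def)
next
  case (Suc m)
  show ?case
  proof (cases "g = []")
    case False
    let ?c = "concat (replicate m g)"
    have g: "last g = a" "a \<in> letters N H" "legal N H g" "H a (hd g)"
      using assms False by (simp_all add: legal_Cons_iff)
    have c: "legal N H ?c" "?c = [] \<or> H a (hd ?c)" "?c = [] \<or> last ?c = a"
      using Suc by (auto simp: legal_Cons_iff split: if_splits)
    have "legal N H (g @ ?c)" using g c by (simp add: legal_append_iff)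
    then have "legal N H (a # g @ ?c)" using g False by (simp add: legal_Cons_iff)
    moreover have "last (a # g @ ?c) = a" using g c False by (auto simp: last_append)
    ultimately show ?thesis by simp
  qed (use assms in \<open>auto simp: legal_def\<close>)
qed

text \<open>Each loop is repeated until it fills the product of all loop lengths. With one common
  length, the length of a code depends only on the number of insertions.\<close>

lemma exists_uniform_loops:
  assumes "transitive_shift (SFT N H)" "y \<in> SFT N H"
  obtains l g where "l > 0" "\<And>a. a \<in> letters N H \<Longrightarrow> length (g a) = l"
    "\<And>a. a \<in> letters N H \<Longrightarrow> last (g a) = a"
    "\<And>a. a \<in> letters N H \<Longrightarrow> legal N H (a # g a)"
    "\<And>a. a \<in> letters N H \<Longrightarrow> sublist (word y (- int K) (2 * K + 1)) (g a)"
proof -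
  have "\<forall>a\<in>letters N H. \<exists>g. g \<noteq> [] \<and> last g = a \<and> legal N H (a # g)
      \<and> sublist (word y (- int K) (2 * K + 1)) g"
    by (intro ballI exists_loop[OF assms])
  from bchoice[OF this] obtain f where "\<forall>a\<in>letters N H. f a \<noteq> [] \<and> last (f a) = a \<and> legal N H (a # f a)
      \<and> sublist (word y (- int K) (2 * K + 1)) (f a)" ..
  note f = bspec[OF this]
  have fin: "finite (letters N H)" by (rule finite_subset[OF letters_subset]) simp
  define l where "l = (\<Prod>a\<in>letters N H. length (f a))"
  have l: "l > 0" unfolding l_def using f by (intro prod_pos) auto
  have dvd: "length (f a) dvd l" if "a \<in> letters N H" for a
    unfolding l_def using fin that by (rule dvd_prodI)
  define g where "g a = concat (replicate (l div length (f a)) (f a))" for a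
  have len: "length (g a) = l" if "a \<in> letters N H" for a
    using dvd_div_mult_self[OF dvd[OF that]] by (simp add: g_def length_concat sum_list_replicate)
  have *: "last (g a) = a \<and> legal N H (a # g a) \<and> sublist (word y (- int K) (2 * K + 1)) (g a)"
    if a: "a \<in> letters N H" for a
  proof -
    have "last (a # f a) = a" "legal N H (a # f a)" using f[OF a] by auto
    then have 1: "legal N H (a # g a) \<and> last (a # g a) = a"
      unfolding g_def by (intro legal_concat_replicate)
    have ne: "g a \<noteq> []" using len[OF a] l by auto
    then have "l div length (f a) \<noteq> 0" by (auto simp: g_def)
    then obtain m where "l div length (f a) = Suc m" using not0_implies_Suc by blast
    then have "sublist (f a) (g a)" by (simp add: g_def)
    then have "sublist (word y (- int K) (2 * K + 1)) (g a)"
      using f[OF a] sublist_order.order_trans by blast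
    then show ?thesis using 1 ne by simp
  qed
  show thesis
    by (rule that[of l g], rule l, erule len) (drule *, elim conjE, assumption)+
qed

section \<open>Coding words by optional loop insertions\<close>

fun enc :: "nat \<Rightarrow> (nat \<Rightarrow> nat list) \<Rightarrow> bool list \<Rightarrow> nat list \<Rightarrow> nat list" where
  "enc L g [] u = u"
| "enc L g (b # bs) u =
    take L u @ (if b then g (last (take L u)) else []) @ enc L g bs (drop L u)"

lemma take_enc:
  assumes "l \<le> L" "L * length bs \<le> length u"
  shows "take l (enc L g bs u) = take l u"
  using assms by (cases bs) auto

text \<open>Decode block by block. If after equal blocks only one code inserts a loop, the other
  code continues with the letters of that loop; since \<open>l \<le> L\<close> these form an
  uninterrupted piece of its source word (\<open>take_enc\<close>), which would then contain
  \<open>w\<close>.\<close>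

lemma enc_inj:
  assumes "0 < L" "l \<le> L" "\<And>a. a \<in> E \<Longrightarrow> length (g a) = l" "\<And>a. a \<in> E \<Longrightarrow> sublist w (g a)"
  assumes "length bs = length bs'" "length u = length u'" "L * length bs \<le> length u"
    "set u \<subseteq> E" "set u' \<subseteq> E" "\<not> sublist w u" "\<not> sublist w u'" "enc L g bs u = enc L g bs' u'"
  shows "bs = bs' \<and> u = u'"
  using assms(5-)
proof (induction bs bs' arbitrary: u u' rule: list_induct2)
  case Nil
  then show ?case by simp
next
  case (Cons b bs b' bs')
  have L: "L \<le> length u" "L \<le> length u'" using Cons.prems by auto
  have tk: "take L u = take L u'"
    using arg_cong[OF Cons.prems(7), of "take L"] L by simp
  \<comment> \<open>Stated for generic codes because it is applied in both orders.\<close>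
  have key: False if b: "c" "\<not> c'" and len: "length v = length u" "length v' = length u"
    "length cs = length bs" "length cs' = length bs" and
    eq: "enc L g (c # cs) v = enc L g (c' # cs') v'" and sub: "set v \<subseteq> E" "\<not> sublist w v'" for c c' cs cs' v v'
  proof -
    have Lv: "L \<le> length v" "L \<le> length v'" using len L by auto
    have "g (last (take L v)) @ enc L g cs (drop L v) = enc L g cs' (drop L v')"
      using arg_cong[OF eq, of "drop L"] b Lv by simp
    moreover have E: "last (take L v) \<in> E"
    proof -
      have "take L v \<noteq> []" using Lv assms(1) by auto
      then show ?thesis using sub(1) by (meson last_in_set in_set_takeD subsetD)
    qed
    ultimately have "g (last (take L v)) = take l (enc L g cs' (drop L v'))"
      using assms(3)[OF E] by (simp add: append_eq_conv_conj)
    also have "\<dots> = take l (drop L v')"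
      using Cons.prems len by (intro take_enc assms(2)) auto
    finally have "sublist w (take l (drop L v'))" using assms(4)[OF E] by simp
    then have "sublist w v'"
      by (rule sublist_order.order_trans[OF _ sublist_order.order_trans[OF sublist_take sublist_drop]])
    then show False using sub(2) by simp
  qed
  have "\<not> (b \<and> \<not> b')"
    using key[of b b' u u' bs bs', OF _ _ refl Cons.prems(1)[symmetric] refl Cons.hyps[symmetric]
        Cons.prems(7,3,6)] by argo
  moreover have "\<not> (b' \<and> \<not> b)"
    using key[of b' b u' u bs' bs, OF _ _ Cons.prems(1)[symmetric] refl Cons.hyps[symmetric] refl
        Cons.prems(7)[symmetric] Cons.prems(4,5)] by argo
  ultimately have "b = b'" by argo
  then have "enc L g bs (drop L u) = enc L g bs' (drop L u')"
    using Cons.prems(7) tk by simp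
  moreover have "\<not> sublist w (drop L u)" "\<not> sublist w (drop L u')"
    using Cons.prems(5,6) sublist_order.order_trans[OF _ sublist_drop, of w L] by blast+
  ultimately have "bs = bs' \<and> drop L u = drop L u'"
    using Cons.prems(1-4) by (intro Cons.IH) (auto dest: in_set_dropD)
  moreover from this have "u = u'"
    using tk by (metis append_take_drop_id)
  ultimately show ?case using \<open>b = b'\<close> by simp
qed

lemma length_enc:
  assumes "0 < L" "\<And>a. a \<in> E \<Longrightarrow> length (g a) = l" "L * length bs \<le> length u" "set u \<subseteq> E"
  shows "length (enc L g bs u) = length u + l * count_list bs True"
  using assms(3-)
proof (induction bs arbitrary: u)
  case (Cons b bs)
  have L: "L \<le> length u" using Cons.prems by auto
  have "take L u \<noteq> []" using L assms(1) by auto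
  then have "last (take L u) \<in> E" using Cons.prems by (meson last_in_set in_set_takeD subsetD)
  moreover have "length (enc L g bs (drop L u)) = length (drop L u) + l * count_list bs True"
    using Cons.prems by (intro Cons.IH) (auto dest: in_set_dropD)
  ultimately show ?case using L assms(2) by auto
qed simp

lemma hd_enc: "0 < L \<Longrightarrow> L * length bs \<le> length u \<Longrightarrow> u \<noteq> [] \<Longrightarrow> enc L g bs u \<noteq> [] \<and> hd (enc L g bs u) = hd u"
  by (cases bs) auto

lemma enc_eq_Nil_iff: "0 < L \<Longrightarrow> L * length bs \<le> length u \<Longrightarrow> enc L g bs u = [] \<longleftrightarrow> u = []"
  by (cases bs) auto

text \<open>A loop ends in the letter behind which it is inserted, so the next block joins it by the
  transition already present in \<open>u\<close>.\<close>

lemma legal_enc: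
  assumes "0 < L"
    "\<And>a. a \<in> letters N H \<Longrightarrow> g a \<noteq> [] \<and> last (g a) = a \<and> legal N H (a # g a)"
    "L * length bs \<le> length u" "legal N H u"
  shows "legal N H (enc L g bs u)"
  using assms(3-)
proof (induction bs arbitrary: u)
  case (Cons b bs)
  have L: "L \<le> length u" using Cons.prems by auto
  have ne: "take L u \<noteq> []" using L assms(1) by auto
  have "legal N H (take L u @ drop L u)" using Cons.prems by simp
  then have *: "legal N H (take L u)" "legal N H (drop L u)"
    "drop L u = [] \<or> H (last (take L u)) (hd (drop L u))"
    using ne unfolding legal_append_iff by auto
  have lu: "last (take L u) \<in> letters N H" using Cons.prems ne
    by (meson last_in_set in_set_takeD legal_iff subsetD)
  have len: "L * length bs \<le> length (drop L u)" using Cons.prems by auto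
  have l: "legal N H (enc L g bs (drop L u))"
    using Cons.prems * by (intro Cons.IH) auto
  have 4: "enc L g bs (drop L u) = [] \<or> H (last (take L u)) (hd (enc L g bs (drop L u)))"
    using *(3) hd_enc[OF assms(1) len] enc_eq_Nil_iff[OF assms(1) len] by metis
  show ?case
  proof (cases b)
    case False
    then show ?thesis using 4 l * by (simp add: legal_append_iff)
  next
    case True
    let ?a = "last (take L u)"
    have g: "g ?a \<noteq> []" "last (g ?a) = ?a" "legal N H (g ?a)" "H ?a (hd (g ?a))"
      using assms(2)[OF lu] by (auto simp: legal_def successively_Cons)
    have "legal N H (g ?a @ enc L g bs (drop L u))"
      using g l 4 unfolding legal_append_iff by auto
    then have "legal N H (take L u @ g ?a @ enc L g bs (drop L u))"
      using g * unfolding legal_append_iff[of N H "take L u"] by auto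
    then show ?thesis using True by simp
  qed
qed simp

section \<open>Weighted count of the codes\<close>

lemma sum_bool_lists: "(\<Sum>bs | length bs = m. q ^ count_list bs True) = (1 + q :: real) ^ m"
proof (induction m)
  case (Suc m)
  have eq: "{bs::bool list. length bs = Suc m} = (#) True ` {bs. length bs = m} \<union> (#) False ` {bs. length bs = m}"
    by (auto simp: length_Suc_conv image_iff)
  have fin: "finite {bs::bool list. length bs = m}"
    using finite_lists_length_eq[of "UNIV::bool set" m] by simp
  have "(\<Sum>bs | length bs = Suc m. q ^ count_list bs True) =
     (\<Sum>bs | length bs = m. q ^ Suc (count_list bs True)) + (\<Sum>bs | length bs = m. q ^ count_list bs True)"
    unfolding eq by (subst sum.union_disjoint) (use fin in \<open>auto simp: sum.reindex\<close>)
  then show ?case using Suc by (simp add: sum_distrib_left[symmetric] algebra_simps)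
qed simp

text \<open>A legal word gets weight \<open>exp (- t * length)\<close> with \<open>t\<close>
  slightly above \<open>s\<close>, so all words together have finite weight. The codes of the
  avoiding words of length \<open>n\<close> carry the weight of those words times
  \<open>(1 + q) ^ (n div l)\<close>, and for \<open>t\<close> near \<open>s\<close> this gain
  outweighs the excess \<open>t - s\<close>.\<close>

lemma avoiding_words_bound:
  assumes "transitive_shift (SFT N H)" "y \<in> SFT N H"
    and w_def: "w = word y (- int K) (2 * K + 1)"
    and growth: "\<And>t. t > s \<Longrightarrow> \<forall>\<^sub>F n in sequentially. real (card (lwords N H n)) \<le> exp (t * real n)"
  shows "\<exists>c<s. \<exists>C>0. \<forall>n. real (card {us \<in> lwords N H n. \<not> sublist w us}) \<le> C * exp (c * real n)"
proof -
  obtain l g where l: "l > 0" and g: "\<And>a. a \<in> letters N H \<Longrightarrow> length (g a) = l"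
    "\<And>a. a \<in> letters N H \<Longrightarrow> last (g a) = a"
    "\<And>a. a \<in> letters N H \<Longrightarrow> legal N H (a # g a)"
    "\<And>a. a \<in> letters N H \<Longrightarrow> sublist w (g a)"
    using exists_uniform_loops[OF assms(1,2)] unfolding w_def by metis
  define V where "V n = {us \<in> lwords N H n. \<not> sublist w us}" for n
  have finV: "finite (V n)" for n unfolding V_def using finite_lwords by simp
  \<comment> \<open>A gain rate valid for every \<open>t \<le> s + 1\<close>; it has to be fixed
    before \<open>t\<close>, which is chosen in terms of it.\<close>
  define \<delta> where "\<delta> = ln (1 + exp (- (s + 1) * real l)) / real l"
  have \<delta>: "\<delta> > 0" using l by (simp add: \<delta>_def ln_gt_zero)
  define t where "t = s + min 1 (\<delta> / 2)"
  have t: "t > s" "t \<le> s + 1" "t \<le> s + \<delta> / 2" using \<delta> by (auto simp: t_def)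
  \<comment> \<open>The weight of one inserted loop.\<close>
  define q where "q = exp (- t * real l)"
  have q: "0 < q" by (simp add: q_def)
  have q': "ln (1 + q) \<ge> \<delta> * real l"
  proof -
    have "t * real l \<le> (s + 1) * real l" using t by (intro mult_right_mono) auto
    then have "exp (- (s + 1) * real l) \<le> q" by (simp add: q_def algebra_simps)
    then have "ln (1 + exp (- (s + 1) * real l)) \<le> ln (1 + q)" by (intro ln_mono) (auto simp: add_pos_pos)
    then show ?thesis using l by (simp add: \<delta>_def)
  qed
  define a where "a n = real (card (lwords N H n)) * exp (- t * real n)" for n
  \<comment> \<open>A rate strictly between \<open>s\<close> and \<open>t\<close>: the growth bound
    at \<open>t'\<close> leaves a geometric series of ratio \<open>exp (t' - t)\<close>.\<close>
  define t' where "t' = (s + t) / 2"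
  have "summable a"
  proof (rule summable_comparison_test_ev)
    have "\<forall>\<^sub>F n in sequentially. real (card (lwords N H n)) \<le> exp (t' * real n)"
      using t by (intro growth) (auto simp: t'_def)
    then show "\<forall>\<^sub>F n in sequentially. norm (a n) \<le> exp (t' - t) ^ n"
    proof eventually_elim
      case (elim n)
      have "a n \<le> exp (t' * real n) * exp (- t * real n)" unfolding a_def using elim by (intro mult_right_mono) auto
      also have "\<dots> = exp (t' - t) ^ n"
        unfolding exp_of_nat_mult[symmetric] exp_add[symmetric] by (simp add: algebra_simps)
      finally show ?case by (simp add: a_def)
    qed
    show "summable (\<lambda>n. exp (t' - t) ^ n)" using t by (intro summable_geometric) (auto simp: t'_def)
  qed
  then obtain Z where Z: "\<And>F. finite F \<Longrightarrow> sum a F \<le> Z"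
    using sum_le_suminf[of a] by (metis a_def exp_ge_zero mult_nonneg_nonneg of_nat_0_le_iff)
  have bound: "real (card (V n)) * exp (- t * real n) * (1 + q) ^ (n div l) \<le> Z" for n
  proof -
    define m where "m = n div l"
    define B where "B = {bs::bool list. length bs = m}"
    have finB: "finite B" unfolding B_def using finite_lists_length_eq[of "UNIV::bool set" m] by simp
    have mn: "l * m \<le> n" by (simp add: m_def)
    define f where "f = (\<lambda>(bs, u). enc l g bs u)"
    define \<phi> where "\<phi> us = exp (- t * real (length us))" for us :: "nat list"
    have inj: "inj_on f (B \<times> V n)"
    proof (rule inj_onI, clarify)
      fix bs u bs' u' assume *: "bs \<in> B" "u \<in> V n" "bs' \<in> B" "u' \<in> V n" "f (bs, u) = f (bs', u')"
      show "bs = bs' \<and> u = u'"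
        by (rule enc_inj[of l l "letters N H" g w])
          (use * l g mn in \<open>auto simp: B_def V_def lwords_def legal_iff f_def\<close>)
    qed
    have len: "length (f (bs, u)) = n + l * count_list bs True" if "bs \<in> B" "u \<in> V n" for bs u
      unfolding f_def prod.case
      by (subst length_enc[of l "letters N H" g l]) (use that l g mn in \<open>auto simp: B_def V_def lwords_def legal_iff\<close>)
    have cnt: "count_list bs True \<le> m" if "bs \<in> B" for bs
      using that count_le_length[of bs True] by (auto simp: B_def)
    have sub: "f ` (B \<times> V n) \<subseteq> (\<Union>k\<le>n + l * m. lwords N H k)"
    proof clarify
      fix bs u assume *: "bs \<in> B" "u \<in> V n"
      have "legal N H (f (bs, u))" unfolding f_def prod.case
        by (rule legal_enc) (use * l g mn in \<open>force simp: B_def V_def lwords_def\<close>)+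
      then show "f (bs, u) \<in> (\<Union>k\<le>n + l * m. lwords N H k)"
        using len[OF *] cnt[OF *(1)] by (auto simp: lwords_def)
    qed
    \<comment> \<open>A code with \<open>i\<close> insertions weighs
      \<open>exp (- t * real n) * q ^ i\<close>; summing over all choices of insertions is the
      binomial expansion \<open>sum_bool_lists\<close>.\<close>
    have "real (card (V n)) * exp (- t * real n) * (1 + q) ^ m
      = (\<Sum>bs\<in>B. \<Sum>u\<in>V n. exp (- t * real n) * q ^ count_list bs True)"
      unfolding sum_bool_lists[symmetric] B_def by (simp add: sum_distrib_left mult.assoc)
    also have "\<dots> = (\<Sum>p\<in>B \<times> V n. exp (- t * real n) * q ^ count_list (fst p) True)"
      unfolding sum.cartesian_product by (rule sum.cong) auto
    also have "\<dots> = (\<Sum>p\<in>B \<times> V n. \<phi> (f p))"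
    proof (rule sum.cong)
      fix p assume "p \<in> B \<times> V n"
      then obtain bs u where p: "p = (bs, u)" "bs \<in> B" "u \<in> V n" by auto
      show "exp (- t * real n) * q ^ count_list (fst p) True = \<phi> (f p)"
        unfolding \<phi>_def p(1) len[OF p(2,3)] q_def exp_of_nat_mult[symmetric] exp_add[symmetric]
        by (simp add: algebra_simps)
    qed simp
    also have "\<dots> = sum \<phi> (f ` (B \<times> V n))" using inj by (simp add: sum.reindex)
    also have "\<dots> \<le> sum \<phi> (\<Union>k\<le>n + l * m. lwords N H k)"
      by (rule sum_mono2) (use sub finite_lwords in \<open>auto simp: \<phi>_def\<close>)
    also have "\<dots> = (\<Sum>k\<le>n + l * m. sum \<phi> (lwords N H k))"
      by (rule sum.UNION_disjoint) (auto simp: finite_lwords, auto simp: lwords_def)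
    also have "\<dots> = (\<Sum>k\<le>n + l * m. a k)"
      by (intro sum.cong) (auto simp: a_def \<phi>_def lwords_def)
    also have "\<dots> \<le> Z" by (rule Z) simp
    finally show ?thesis by (simp add: m_def)
  qed
  have Z0: "Z \<ge> 0" using Z[of "{}"] by simp
  \<comment> \<open>Half of the gain \<open>\<delta>\<close> pays for \<open>t\<close> exceeding
    \<open>s\<close>, and the other half remains: \<open>t - \<delta> \<le> c\<close>.\<close>
  define c where "c = s - \<delta> / 2"
  \<comment> \<open>The summand 1 keeps the constant positive even when
    \<open>Z = 0\<close>.\<close>
  have "real (card (V n)) \<le> (Z * (1 + q) + 1) * exp (c * real n)" for n
  proof -
    \<comment> \<open>Rounding down loses less than one block, at the cost of one factor
      \<open>1 + q\<close>.\<close>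
    have "real n / real l \<le> real (n div l) + 1"
    proof -
      have "n < l * Suc (n div l)" using l by (simp add: dividend_less_times_div)
      then have "real n \<le> real l * (real (n div l) + 1)"
        by (metis less_imp_le of_nat_Suc of_nat_le_iff of_nat_mult add.commute)
      then show ?thesis using l by (simp add: field_simps)
    qed
    then have "ln (1 + q) * (real n / real l) \<le> ln (1 + q) * (real (n div l) + 1)"
      using q by (intro mult_left_mono) (auto intro: ln_ge_zero)
    moreover have "\<delta> * real n \<le> ln (1 + q) * (real n / real l)"
    proof -
      have "\<delta> * real l * (real n / real l) \<le> ln (1 + q) * (real n / real l)"
        by (rule mult_right_mono[OF q']) auto
      then show ?thesis using l by simp
    qed
    ultimately have "exp (\<delta> * real n) \<le> exp (ln (1 + q) * (real (n div l) + 1))" by simp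
    also have "\<dots> = (1 + q) ^ Suc (n div l)"
      using q exp_of_nat_mult[of "Suc (n div l)" "ln (1+q)"] by (simp add: mult.commute add.commute)
    finally have 1: "exp (\<delta> * real n) \<le> (1 + q) ^ Suc (n div l)" .
    have "real (card (V n)) * exp (- t * real n) * exp (\<delta> * real n)
       \<le> real (card (V n)) * exp (- t * real n) * (1 + q) ^ Suc (n div l)"
      using 1 by (intro mult_left_mono) auto
    also have "\<dots> = (real (card (V n)) * exp (- t * real n) * (1 + q) ^ (n div l)) * (1 + q)" by simp
    also have "\<dots> \<le> Z * (1 + q)" using bound[of n] q by (intro mult_right_mono) auto
    finally have "real (card (V n)) * exp ((\<delta> - t) * real n) \<le> Z * (1 + q)"
      unfolding mult.assoc exp_add[symmetric] by (simp add: algebra_simps)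
    then have "real (card (V n)) * exp ((\<delta> - t) * real n) * exp ((t - \<delta>) * real n) \<le> Z * (1 + q) * exp ((t - \<delta>) * real n)"
      by (intro mult_right_mono) auto
    then have "real (card (V n)) \<le> Z * (1 + q) * exp ((t - \<delta>) * real n)"
      unfolding mult.assoc exp_add[symmetric] by (simp add: algebra_simps)
    also have "\<dots> \<le> (Z * (1 + q) + 1) * exp (c * real n)"
      using t Z0 q by (intro mult_mono) (auto simp: c_def intro!: mult_right_mono)
    finally show ?thesis .
  qed
  moreover have "Z * (1 + q) + 1 > 0" using Z0 q by (simp add: add_nonneg_pos)
  moreover have "c < s" using \<delta> by (simp add: c_def)
  ultimately show ?thesis unfolding V_def by blast
qed


subsection \<open>Entropy of subsets avoiding a word\<close>

text \<open>One point per word gives a separated set: where two words differ, the shifted points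
  differ at index 0 and hence have distance at least 1.\<close>

lemma card_lwords_le_sep_num:
  assumes "n > 0"
  shows "enat (card (lwords N H n)) \<le> sep_num n (1/2) (SFT N H)"
proof -
  have "\<exists>x\<in>SFT N H. word x 0 n = us" if "us \<in> lwords N H n" for us
  proof -
    have "length us = n" "legal N H us" "us \<noteq> []" using that assms by (auto simp: lwords_def)
    then show ?thesis using legal_imp_word by metis
  qed
  then have "\<forall>us\<in>lwords N H n. \<exists>x. x \<in> SFT N H \<and> word x 0 n = us" by blast
  from bchoice[OF this] obtain f
    where f: "\<forall>us\<in>lwords N H n. f us \<in> SFT N H \<and> word (f us) 0 n = us" ..
  have inj: "inj_on f (lwords N H n)" using f by (metis inj_onI)
  have "f ` lwords N H n \<in> sep_sets n (1/2) (SFT N H)"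
    unfolding sep_sets_def
  proof (intro CollectI conjI ballI impI)
    fix x y assume "x \<in> f ` lwords N H n" "y \<in> f ` lwords N H n" "x \<noteq> y"
    then have "word x 0 n \<noteq> word y 0 n" using f by auto
    then obtain k where k: "k < n" "x (int k) \<noteq> y (int k)" by (auto simp: word_eq_iff)
    then have "\<not> agree 0 (shiftn (int k) x) (shiftn (int k) y)" by (simp add: agree_def shiftn_def)
    then have "\<not> sdist (shiftn (int k) x) (shiftn (int k) y) < 1"
      using sdist_less_imp_agree[of "shiftn (int k) x" "shiftn (int k) y" 0] by auto
    then show "\<exists>k<n. 1 / 2 < sdist (shiftn (int k) x) (shiftn (int k) y)"
      using k by (intro exI[of _ k]) auto
  qed (use f finite_lwords in auto)
  then have "enat (card (f ` lwords N H n)) \<le> sep_num n (1/2) (SFT N H)"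
    unfolding sep_num_def by (rule SUP_upper)
  then show ?thesis using card_image[OF inj] by simp
qed

text \<open>Entropy is a supremum over scales, so it dominates the rate at scale 1/2, where
  separated sets already see all words.\<close>

lemma card_lwords_growth:
  assumes "htop (SFT N H) < ereal t"
  shows "\<forall>\<^sub>F n in sequentially. real (card (lwords N H n)) \<le> exp (t * real n)"
proof -
  have "limsup (\<lambda>n. sep_rate n (1/2) (SFT N H)) \<le> htop (SFT N H)"
    unfolding htop_def by (rule SUP_upper) simp
  then have "limsup (\<lambda>n. sep_rate n (1/2) (SFT N H)) < ereal t" using assms by simp
  then have "\<forall>\<^sub>F n in sequentially. sep_rate n (1/2) (SFT N H) < ereal t" by (rule Limsup_lessD)
  then show ?thesis using eventually_gt_at_top[of 0]
  proof eventually_elim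
    case (elim n)
    then obtain m where m: "sep_num n (1/2) (SFT N H) = enat m"
      by (cases "sep_num n (1/2) (SFT N H)") (auto simp: sep_rate_def)
    have le: "card (lwords N H n) \<le> m" using card_lwords_le_sep_num[of n N H] elim m by simp
    show ?case
    proof (cases "m = 0")
      case False
      then have "ln (real m) / real n < t" using elim m by (simp add: sep_rate_def)
      then have "ln (real m) \<le> t * real n" using elim by (simp add: field_simps)
      then have "real m \<le> exp (t * real n)" using False
        by (metis exp_ln exp_le_cancel_iff of_nat_0_less_iff gr0I)
      then show ?thesis using le by linarith
    qed (use le in simp)
  qed
qed

lemma sep_rate_le:
  assumes "sep_num n e Y \<le> enat M" "real M \<le> exp r" "n > 0"
  shows "sep_rate n e Y \<le> ereal (r / real n)"
proof -
  obtain m where m: "sep_num n e Y = enat m" using assms(1) by (cases "sep_num n e Y") auto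
  then have "m \<le> M" using assms(1) by simp
  then have "real m \<le> exp r" using assms(2) by linarith
  then have "m \<noteq> 0 \<Longrightarrow> ln (real m) \<le> r" by (metis ln_exp ln_mono of_nat_0_less_iff gr0I)
  then show ?thesis using m assms(3) by (auto simp: sep_rate_def divide_right_mono)
qed

text \<open>Separation at scale \<open>e\<close> up to time \<open>n\<close> is decided by the
  coordinates from \<open>- k\<close> to \<open>n + k - 1\<close>. The nonnegative ones form an
  avoiding word; about the \<open>k\<close> earlier letters nothing is known, which costs the factor
  \<open>N ^ k\<close>.\<close>

lemma sep_num_le_words:
  assumes Y: "Y \<subseteq> SFT N H" "\<And>x m. x \<in> Y \<Longrightarrow> \<not> sublist w (word x 0 m)" and k: "(1/2) ^ k < e"
  shows "sep_num n e Y \<le> enat (N ^ k * card {us \<in> lwords N H (n + k). \<not> sublist w us})"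
  unfolding sep_num_def
proof (rule SUP_least)
  fix S assume S: "S \<in> sep_sets n e Y"
  define f where "f x = (word x (- int k) k, word x 0 (n + k))" for x
  let ?A = "{us. set us \<subseteq> {1..N} \<and> length us = k}" and ?B = "{us \<in> lwords N H (n + k). \<not> sublist w us}"
  have inj: "inj_on f S"
  proof (rule inj_onI, rule ccontr)
    fix x y assume xy: "x \<in> S" "y \<in> S" "f x = f y" "x \<noteq> y"
    then obtain j where j: "j < n" "sdist (shiftn (int j) x) (shiftn (int j) y) > e"
      using S unfolding sep_sets_def by blast
    have "word x (- int k) (k + (n + k)) = word y (- int k) (k + (n + k))"
      using xy(3) by (simp add: f_def word_append[of _ "- int k" k])
    then have eq: "x (- int k + int i) = y (- int k + int i)" if "i < k + (n + k)" for i
      using that unfolding word_eq_iff by blast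
    have "agree k (shiftn (int j) x) (shiftn (int j) y)"
      unfolding agree_def shiftn_def
    proof (intro allI impI)
      fix i assume "\<bar>i\<bar> \<le> int k"
      then have "nat (i + int j + int k) < k + (n + k)" "- int k + int (nat (i + int j + int k)) = i + int j"
        using j by auto
      then show "x (i + int j) = y (i + int j)" using eq by metis
    qed
    from agree_imp_sdist_le[OF this] have "sdist (shiftn (int j) x) (shiftn (int j) y) \<le> (1/2) ^ k"
      by (rule order_trans) auto
    then show False using j k by simp
  qed
  have sub: "f ` S \<subseteq> ?A \<times> ?B"
  proof (rule image_subsetI)
    fix x assume "x \<in> S"
    then have x: "x \<in> Y" "x \<in> SFT N H" using S Y by (auto simp: sep_sets_def)
    have "set (word x (- int k) k) \<subseteq> {1..N}"
      using x by (auto simp: word_def SFT_def)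
    then show "f x \<in> ?A \<times> ?B"
      using Y(2)[OF x(1)] legal_word[OF x(2)] by (simp add: lwords_def f_def)
  qed
  have "finite (?A \<times> ?B)" by (simp add: finite_lists_length_eq finite_lwords)
  then have "card S \<le> card (?A \<times> ?B)" by (rule card_inj_on_le[OF inj sub])
  then show "enat (card S) \<le> enat (N ^ k * card ?B)"
    by (simp add: card_cartesian_product card_lists_length_eq)
qed

lemma htop_le_of_words_bound:
  assumes Y: "Y \<subseteq> SFT N H" "\<And>x m. x \<in> Y \<Longrightarrow> \<not> sublist w (word x 0 m)"
    and C: "C > 0" "\<And>n. real (card {us \<in> lwords N H n. \<not> sublist w us}) \<le> C * exp (c * real n)"
    and N: "N > 0"
  shows "htop Y \<le> ereal c"
  unfolding htop_def
proof (rule SUP_least)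
  fix e :: real assume "e \<in> {0<..}"
  then obtain k where k: "(1/2) ^ k < e" using half_power_less by auto
  \<comment> \<open>Collects everything that does not grow with \<open>n\<close>; divided by
    \<open>n\<close> it vanishes in the limit.\<close>
  define D where "D = ln (real N ^ k * C) + c * real k"
  have "sep_rate n e Y \<le> ereal (D / real n + c)" if "n > 0" for n
  proof -
    have "real (N ^ k * card {us \<in> lwords N H (n + k). \<not> sublist w us})
       \<le> real N ^ k * (C * exp (c * real (n + k)))"
      using C(2)[of "n + k"] by (simp add: mult_left_mono)
    also have "\<dots> = exp (D + c * real n)"
      using C N by (simp add: D_def exp_add algebra_simps)
    finally have "sep_rate n e Y \<le> ereal ((D + c * real n) / real n)"
      using sep_rate_le[OF sep_num_le_words[OF Y k] _ that] by blast
    also have "(D + c * real n) / real n = D / real n + c" using that by (simp add: field_simps)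
    finally show ?thesis .
  qed
  then have "\<forall>\<^sub>F n in sequentially. sep_rate n e Y \<le> ereal (D / real n + c)"
    by (rule eventually_mono[OF eventually_gt_at_top[of 0]])
  then have "limsup (\<lambda>n. sep_rate n e Y) \<le> limsup (\<lambda>n. ereal (D / real n + c))"
    by (rule Limsup_mono)
  also have "\<dots> = ereal c"
  proof (rule lim_imp_Limsup)
    have "(\<lambda>n. D / real n + c) \<longlonglongrightarrow> 0 + c" by (intro tendsto_intros lim_const_over_n)
    then show "(\<lambda>n. ereal (D / real n + c)) \<longlonglongrightarrow> ereal c" by simp
  qed simp
  finally show "limsup (\<lambda>n. sep_rate n e Y) \<le> ereal c" .
qed

proposition htop_avoiding_less:
  assumes trans: "transitive_shift (SFT N H)" and y: "y \<in> SFT N H" and pos: "htop (SFT N H) > 0"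
  shows "\<exists>c. ereal c < htop (SFT N H) \<and>
    (\<forall>Y\<subseteq>SFT N H. (\<forall>x\<in>Y. \<forall>n::nat. \<not> agree K (shiftn (int n) x) y) \<longrightarrow> htop Y \<le> ereal c)"
proof -
  define w where "w = word y (- int K) (2 * K + 1)"
  have N: "N > 0" using y by (force simp: SFT_def)
  \<comment> \<open>The counting bound needs a real rate \<open>s\<close>. The case of an infinite
    value is not refuted but served by the crude count \<open>N ^ n\<close>, with rate
    \<open>ln N\<close>.\<close>
  have "\<exists>s. ereal s \<le> htop (SFT N H) \<and>
      (\<forall>t>s. \<forall>\<^sub>F n in sequentially. real (card (lwords N H n)) \<le> exp (t * real n))"
  proof (cases "htop (SFT N H)")
    case (real s)
    then show ?thesis using card_lwords_growth[of N H] by (intro exI[of _ s]) auto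
  next
    case PInf
    have "real (card (lwords N H n)) \<le> exp (t * real n)" if "t > ln (real N)" for t n
    proof -
      have "real (card (lwords N H n)) \<le> real N ^ n"
        using card_lwords_le[of N H n] by (metis of_nat_le_iff of_nat_power)
      also have "\<dots> = exp (ln (real N)) ^ n" using N by simp
      also have "\<dots> = exp (real n * ln (real N))" by (rule exp_of_nat_mult[symmetric])
      also have "\<dots> \<le> exp (t * real n)" using that by (simp add: mult.commute[of t] mult_left_mono)
      finally show ?thesis .
    qed
    then show ?thesis using PInf by (intro exI[of _ "ln (real N)"]) auto
  next
    case MInf
    then show ?thesis using pos by simp
  qed
  then obtain s where s: "ereal s \<le> htop (SFT N H)"
    "\<And>t. t > s \<Longrightarrow> \<forall>\<^sub>F n in sequentially. real (card (lwords N H n)) \<le> exp (t * real n)" by auto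
  obtain c C where c: "c < s" "C > 0"
    "\<And>n. real (card {us \<in> lwords N H n. \<not> sublist w us}) \<le> C * exp (c * real n)"
    using avoiding_words_bound[OF trans y w_def, where s = s, OF s(2)] by auto
  have "htop Y \<le> ereal c"
    if Y: "Y \<subseteq> SFT N H" "\<forall>x\<in>Y. \<forall>n::nat. \<not> agree K (shiftn (int n) x) y" for Y
  proof (rule htop_le_of_words_bound[OF Y(1) _ c(2,3) N])
    fix x m assume x: "x \<in> Y"
    show "\<not> sublist w (word x 0 m)"
    proof
      assume "sublist w (word x 0 m)"
      then obtain us vs where us: "word x 0 m = us @ w @ vs" by (auto simp: sublist_def)
      have len: "length us + (2 * K + 1) \<le> m"
        using arg_cong[OF us, of length] by (simp add: w_def)
      have "x (int (length us) + int i) = y (- int K + int i)" if "i < 2 * K + 1" for i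
      proof -
        have "word x 0 m ! (length us + i) = w ! i" using us that by (simp add: nth_append w_def)
        then show ?thesis using len that by (simp add: w_def)
      qed
      \<comment> \<open>The occurrence starts at \<open>length us\<close>; the centre of the window
        lies \<open>K\<close> letters further on.\<close>
      then have "agree K (shiftn (int (length us + K)) x) y"
        unfolding agree_iff_word word_eq_iff by (auto simp: shiftn_def algebra_simps)
      then show False using Y(2) x by blast
    qed
  qed
  moreover have "ereal c < htop (SFT N H)" using c(1) s(1) by (meson ereal_less_eq(3) less_ereal.simps(1) less_le_trans)
  ultimately show ?thesis by blast
qed

subsection \<open>Matrices and operator bounds\<close>

text \<open>The type-class \<open>norm\<close> of a matrix is the Euclidean one, so operator bounds
  are carried separately; mixed products of the two lose no dimension factor.\<close>

definition op_bound :: "real^'d^'d \<Rightarrow> real \<Rightarrow> bool" where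
  "op_bound M b \<longleftrightarrow> (\<forall>v. norm (M *v v) \<le> b * norm v)"

lemma norm_matrix_sq: "(norm (M :: real^'n^'m))\<^sup>2 = (\<Sum>i\<in>UNIV. (norm (M $ i))\<^sup>2)"
  unfolding power2_norm_eq_inner by (simp add: inner_vec_def)

lemma norm_transpose: "norm (transpose M) = norm (M :: real^'n^'m)"
proof -
  have "(norm (transpose M))\<^sup>2 = (\<Sum>i\<in>UNIV. \<Sum>j\<in>UNIV. (M $ j $ i)\<^sup>2)"
    unfolding power2_norm_eq_inner by (simp add: inner_vec_def transpose_def power2_eq_square)
  also have "\<dots> = (\<Sum>j\<in>UNIV. \<Sum>i\<in>UNIV. (M $ j $ i)\<^sup>2)" by (rule sum.swap)
  also have "\<dots> = (norm M)\<^sup>2"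
    unfolding power2_norm_eq_inner by (simp add: inner_vec_def power2_eq_square)
  finally show ?thesis by simp
qed

lemma inner_matrix_transpose: "(M *v x) \<bullet> y = x \<bullet> (transpose M *v (y :: real^'m))" for M :: "real^'n^'m"
  by (metis dot_lmul_matrix inner_commute vector_transpose_matrix transpose_transpose)

text \<open>The squared norm of \<open>transpose M *v v\<close> is the inner product of
  \<open>M *v (transpose M *v v)\<close> with \<open>v\<close>; Cauchy-Schwarz and cancellation do
  the rest.\<close>

lemma op_bound_transpose:
  assumes "op_bound M b"
  shows "op_bound (transpose M) b"
  unfolding op_bound_def
proof
  fix v
  let ?w = "transpose M *v v"
  have "norm ?w * norm ?w = (M *v ?w) \<bullet> v"
    by (simp add: inner_matrix_transpose norm_eq_sqrt_inner)
  also have "\<dots> \<le> norm (M *v ?w) * norm v" by (rule norm_cauchy_schwarz)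
  also have "\<dots> \<le> b * norm ?w * norm v"
    using assms by (intro mult_right_mono) (auto simp: op_bound_def)
  finally have "norm ?w * norm ?w \<le> (b * norm v) * norm ?w" by (simp add: mult_ac)
  moreover have "0 \<le> b * norm v" using assms norm_ge_zero order_trans unfolding op_bound_def by blast
  ultimately show "norm ?w \<le> b * norm v"
    by (metis mult_le_cancel_right norm_ge_zero order.order_iff_strict)
qed

text \<open>Each row of \<open>A ** B\<close> is \<open>transpose B\<close> applied to a row of
  \<open>A\<close>. Small differences can thus be multiplied by long bounded products at the cost of
  one factor.\<close>

lemma norm_mult_le_right:
  assumes "op_bound B b"
  shows "norm (A ** B) \<le> b * norm A"
proof -
  have b: "b \<ge> 0"
  proof -
    have "0 \<le> b * norm (axis undefined 1 :: real^'a)" using assms norm_ge_zero order_trans unfolding op_bound_def by blast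
    then show ?thesis by simp
  qed
  have "(A ** B) $ i = transpose B *v (A $ i)" for i
    by (simp add: vec_eq_iff matrix_matrix_mult_def matrix_vector_mult_def transpose_def mult.commute)
  then have "norm ((A ** B) $ i) \<le> b * norm (A $ i)" for i
    using op_bound_transpose[OF assms] by (simp add: op_bound_def)
  then have "(norm (A ** B))\<^sup>2 \<le> (\<Sum>i\<in>UNIV. (b * norm (A $ i))\<^sup>2)"
    unfolding norm_matrix_sq by (intro sum_mono power_mono) auto
  also have "\<dots> = (b * norm A)\<^sup>2"
    by (simp add: norm_matrix_sq power_mult_distrib sum_distrib_left)
  finally show ?thesis using b by (simp add: power2_le_iff_abs_le)
qed

lemma norm_mult_le_left:
  assumes "op_bound A a"
  shows "norm (A ** B) \<le> a * norm B"
proof -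
  have "norm (A ** B) = norm (transpose B ** transpose A)"
    by (metis norm_transpose matrix_transpose_mul)
  also have "\<dots> \<le> a * norm (transpose B)" by (rule norm_mult_le_right[OF op_bound_transpose[OF assms]])
  finally show ?thesis by (simp add: norm_transpose)
qed

lemma norm_matrix_vector_le: "norm (M *v v) \<le> norm M * norm v" for M :: "real^'n^'m"
proof -
  have "(norm (M *v v))\<^sup>2 = (\<Sum>i\<in>UNIV. ((M $ i) \<bullet> v)\<^sup>2)"
    unfolding power2_norm_eq_inner by (simp add: inner_vec_def matrix_mult_dot power2_eq_square)
  also have "\<dots> \<le> (\<Sum>i\<in>UNIV. (norm (M $ i) * norm v)\<^sup>2)"
    by (intro sum_mono) (metis Cauchy_Schwarz_ineq2 abs_le_square_iff abs_mult abs_norm_cancel)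
  also have "\<dots> = (norm M * norm v)\<^sup>2"
    by (simp add: norm_matrix_sq power_mult_distrib sum_distrib_right)
  finally show ?thesis by (simp add: power2_le_iff_abs_le)
qed

lemma op_bound_norm: "op_bound M (norm M)"
  by (simp add: op_bound_def norm_matrix_vector_le)

lemma norm_matrix_mult_le: "norm (A ** B) \<le> norm A * norm (B :: real^'d^'d)" for A :: "real^'d^'d"
  by (rule norm_mult_le_left[OF op_bound_norm])

lemma matrix_scaleR_left: "(r *\<^sub>R A) ** B = r *\<^sub>R (A ** B)" for A :: "real^'n^'m" and B :: "real^'k^'n"
  by (simp add: vec_eq_iff matrix_matrix_mult_def sum_distrib_left mult.assoc)

lemma matrix_scaleR_right: "A ** (r *\<^sub>R B) = r *\<^sub>R (A ** B)" for A :: "real^'n^'m" and B :: "real^'k^'n"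
  by (simp add: vec_eq_iff matrix_matrix_mult_def sum_distrib_left mult_ac)

lemma matrix_add_left: "(A + B) ** C = A ** C + B ** C" for A B :: "real^'n^'m" and C :: "real^'k^'n"
  by (simp add: vec_eq_iff matrix_matrix_mult_def algebra_simps sum.distrib)

lemma matrix_diff_left: "(A - B) ** C = A ** C - B ** C" for A B :: "real^'n^'m" and C :: "real^'k^'n"
  by (simp add: vec_eq_iff matrix_matrix_mult_def algebra_simps sum_subtractf)

lemma matrix_diff_right: "C ** (A - B) = C ** A - C ** B" for A B :: "real^'k^'n" and C :: "real^'n^'m"
  by (simp add: vec_eq_iff matrix_matrix_mult_def algebra_simps sum_subtractf)

lemma transpose_diff: "transpose (A - B) = transpose A - transpose (B :: real^'n^'m)"
  by (simp add: vec_eq_iff transpose_def)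

lemma transpose_add: "transpose (A + B) = transpose A + transpose (B :: real^'n^'m)"
  by (simp add: vec_eq_iff transpose_def)

lemma transpose_scaleR: "transpose (r *\<^sub>R A) = r *\<^sub>R transpose (A :: real^'n^'m)"
  by (simp add: vec_eq_iff transpose_def)

lemma bounded_bilinear_matrix_mult:
  "bounded_bilinear ((**) :: real^'d^'d \<Rightarrow> real^'d^'d \<Rightarrow> real^'d^'d)"
proof
  show "\<exists>K. \<forall>(a :: real^'d^'d) b :: real^'d^'d. norm (a ** b) \<le> norm a * norm b * K"
    by (rule exI[of _ 1]) (simp add: norm_matrix_mult_le)
qed (auto simp: matrix_add_ldistrib matrix_add_left matrix_scaleR_left matrix_scaleR_right)

lemma bounded_bilinear_matrix_vector_mult:
  "bounded_bilinear ((*v) :: real^'d^'d \<Rightarrow> real^'d \<Rightarrow> real^'d)"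
proof
  show "\<exists>K. \<forall>a b. norm (a *v b :: real^'d) \<le> norm (a :: real^'d^'d) * norm b * K"
    by (rule exI[of _ 1]) (simp add: norm_matrix_vector_le)
qed (auto simp: matrix_vector_mult_add_rdistrib matrix_vector_right_distrib scaleR_matrix_vector_assoc
    matrix_vector_mult_scaleR)

lemmas tendsto_matrix_mult = bounded_bilinear.tendsto[OF bounded_bilinear_matrix_mult]
lemmas tendsto_matrix_vector_mult = bounded_bilinear.tendsto[OF bounded_bilinear_matrix_vector_mult]
lemmas continuous_on_matrix_mult = bounded_bilinear.continuous_on[OF bounded_bilinear_matrix_mult]
lemmas continuous_on_matrix_vector_mult = bounded_bilinear.continuous_on[OF bounded_bilinear_matrix_vector_mult]

lemma continuous_on_transpose:
  assumes "continuous_on S f"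
  shows "continuous_on S (\<lambda>x. transpose (f x :: real^'n^'m))"
proof -
  have "bounded_linear (transpose :: real^'n^'m \<Rightarrow> _)"
    by (rule bounded_linear_intro[of _ 1]) (auto simp: transpose_add transpose_scaleR norm_transpose)
  then show ?thesis using assms by (rule bounded_linear.continuous_on)
qed

section \<open>Operator norm versus Euclidean norm, and quasi-isometries\<close>

lemma mnorm_le_norm: "mnorm M \<le> norm M"
  unfolding mnorm_def by (rule onorm_le) (rule norm_matrix_vector_le)

lemma norm_le_mnorm: "norm M \<le> real (CARD('d) * CARD('d)) * mnorm (M :: real^'d^'d)"
proof -
  have "norm M \<le> (\<Sum>i\<in>UNIV. norm (M $ i))" unfolding norm_vec_def by (rule L2_set_le_sum) simp
  also have "\<dots> \<le> (\<Sum>i::'d\<in>UNIV. \<Sum>j::'d\<in>UNIV. mnorm M)"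
    unfolding mnorm_def
    by (intro sum_mono order_trans[OF norm_le_l1_cart]) (rule matrix_component_le_onorm)
  finally show ?thesis by simp
qed

lemma norm_matrix_vector_le_mnorm: "norm (M *v v) \<le> mnorm M * norm v"
  unfolding mnorm_def by (rule onorm[OF matrix_vector_mul_bounded_linear])

lemma op_bound_mult: "op_bound A a \<Longrightarrow> op_bound B b \<Longrightarrow> a \<ge> 0 \<Longrightarrow> op_bound (A ** B) (a * b)"
  unfolding op_bound_def matrix_vector_mul_assoc[symmetric] mult.assoc
  by (meson mult_left_mono order_trans)

text \<open>Bounds a matrix and its inverse by \<open>\<kappa>\<close> without mentioning the
  inverse; in this form the condition is visibly closed under limits.\<close>

definition quasi_isom :: "real \<Rightarrow> real^'d^'d \<Rightarrow> bool" where
  "quasi_isom \<kappa> M \<longleftrightarrow> (\<forall>v. norm (M *v v) \<le> \<kappa> * norm v \<and> norm v \<le> \<kappa> * norm (M *v v))"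

lemma quasi_isom_op_bound: "quasi_isom \<kappa> M \<Longrightarrow> op_bound M \<kappa>"
  by (simp add: quasi_isom_def op_bound_def)

lemma quasi_isom_inverse:
  assumes "quasi_isom \<kappa> M"
  obtains M' where "M' ** M = mat 1" "M ** M' = mat 1" "op_bound M' \<kappa>"
proof -
  have "inj ((*v) M)"
    unfolding vec.inj_iff_eq_0
  proof (intro allI impI)
    fix v assume "M *v v = 0"
    then have "norm v \<le> 0" using assms unfolding quasi_isom_def by (metis mult_zero_right norm_zero)
    then show "v = 0" by simp
  qed
  then obtain M' where M': "M' ** M = mat 1" by (metis matrix_left_invertible_injective)
  then have 2: "M ** M' = mat 1" by (metis matrix_left_right_inverse)
  have "norm (M' *v v) \<le> \<kappa> * norm v" for v
    using assms 2 unfolding quasi_isom_def by (metis matrix_vector_mul_assoc matrix_vector_mul_lid)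
  then show thesis using that M' 2 by (auto simp: op_bound_def)
qed

lemma quasi_isom_transpose:
  assumes "quasi_isom \<kappa> M"
  shows "quasi_isom \<kappa> (transpose M)"
proof -
  obtain M' where M': "M' ** M = mat 1" "M ** M' = mat 1" "op_bound M' \<kappa>"
    using quasi_isom_inverse[OF assms] .
  have "transpose M' ** transpose M = mat 1"
    by (metis M'(2) matrix_transpose_mul transpose_mat)
  then have "norm v \<le> \<kappa> * norm (transpose M *v v)" for v
    using op_bound_transpose[OF M'(3)] unfolding op_bound_def
    by (metis matrix_vector_mul_assoc matrix_vector_mul_lid)
  then show ?thesis using op_bound_transpose[OF quasi_isom_op_bound[OF assms]]
    by (simp add: quasi_isom_def op_bound_def)
qed

subsection \<open>A common fixed point\<close>

text \<open>Kakutani's argument: the invariant norm \<open>sup\<^sub>g \<bar>g p\<bar>\<close> is strictly convex, because the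
  parallelogram law holds uniformly in \<open>g\<close>; hence it has a unique minimiser on \<open>K\<close>.\<close>

lemma semigroup_common_fixpoint:
  fixes G :: "('a::euclidean_space \<Rightarrow> 'a) set"
  assumes lin: "\<And>g. g \<in> G \<Longrightarrow> linear g"
    and comp: "\<And>g h. g \<in> G \<Longrightarrow> h \<in> G \<Longrightarrow> h \<circ> g \<in> G"
    and ub: "\<And>g v. g \<in> G \<Longrightarrow> norm (g v) \<le> b * norm v"
    and lb: "\<And>g v. g \<in> G \<Longrightarrow> a * norm v \<le> norm (g v)" and a: "a > 0"
    and K: "compact K" "convex K" "K \<noteq> {}"
    and inv: "\<And>g p. g \<in> G \<Longrightarrow> p \<in> K \<Longrightarrow> g p \<in> K"
  shows "\<exists>p\<in>K. \<forall>g\<in>G. g p = p"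
proof (cases "G = {}")
  case False
  define n where "n p = (SUP g\<in>G. norm (g p))" for p
  have bdd: "bdd_above ((\<lambda>g. norm (g p)) ` G)" for p
    using ub by (intro bdd_aboveI2) blast
  have le_n: "norm (g p) \<le> n p" if "g \<in> G" for g p
    unfolding n_def using bdd that by (intro cSUP_upper) auto
  have n_le: "n p \<le> r" if "\<And>g. g \<in> G \<Longrightarrow> norm (g p) \<le> r" for p r
    unfolding n_def using False that by (intro cSUP_least) auto
  have lip: "n p - n q \<le> b * norm (p - q)" for p q
  proof -
    have "n p \<le> n q + b * norm (p - q)"
    proof (rule n_le)
      fix g assume g: "g \<in> G"
      have "g p = g q + g (p - q)" using lin[OF g] by (simp add: linear_diff)
      then have "norm (g p) \<le> norm (g q) + norm (g (p - q))" by (metis norm_triangle_ineq)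
      then show "norm (g p) \<le> n q + b * norm (p - q)" using le_n[OF g, of q] ub[OF g, of "p - q"] by linarith
    qed
    then show ?thesis by simp
  qed
  have "continuous_on K n"
    unfolding continuous_on_iff
  proof (intro ballI allI impI)
    fix p and e :: real assume "e > 0"
    let ?d = "e / (\<bar>b\<bar> + 1)"
    have "dist (n q) (n p) < e" if "dist q p < ?d" for q
    proof -
      have "\<bar>n q - n p\<bar> \<le> \<bar>b\<bar> * norm (q - p)"
        using lip[of p q] lip[of q p] by (smt (verit) mult_right_mono norm_ge_zero norm_minus_commute)
      also have "\<dots> \<le> (\<bar>b\<bar> + 1) * norm (q - p)" by (intro mult_right_mono) auto
      also have "\<dots> < e" using that by (simp add: dist_norm field_simps)
      finally show ?thesis by (simp add: dist_real_def)
    qed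
    moreover have "?d > 0" using \<open>e > 0\<close> by (simp add: add_nonneg_pos)
    ultimately show "\<exists>d>0. \<forall>x'\<in>K. dist x' p < d \<longrightarrow> dist (n x') (n p) < e" by blast
  qed
  then obtain p where p: "p \<in> K" "\<And>q. q \<in> K \<Longrightarrow> n p \<le> n q"
    using continuous_attains_inf[OF K(1,3)] by metis
  have "g p = p" if g: "g \<in> G" for g
  proof -
    define q where "q = g p"
    have q: "q \<in> K" using inv[OF g p(1)] by (simp add: q_def)
    \<comment> \<open>The orbit of \<open>g p\<close> under \<open>G\<close> is part of the orbit of
      \<open>p\<close>, so \<open>g\<close> cannot raise the supremum.\<close>
    have nq: "n q \<le> n p"
    proof (rule n_le)
      fix h assume "h \<in> G"
      then show "norm (h q) \<le> n p" using le_n[OF comp[OF g], of h p] by (simp add: q_def)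
    qed
    define m where "m = (1/2) *\<^sub>R p + (1/2) *\<^sub>R q"
    have "m \<in> K" unfolding m_def using K(2) p(1) q by (intro convexD) auto
    then have nm: "n p \<le> n m" by (rule p(2))
    \<comment> \<open>The parallelogram law at the midpoint \<open>m\<close>: by \<open>lb\<close>
      the loss is the same for every \<open>h\<close>, hence survives the supremum and contradicts
      minimality unless \<open>p = q\<close>.\<close>
    define r where "r = (n p)\<^sup>2 - a\<^sup>2 * (norm (p - q))\<^sup>2 / 4"
    have r: "(norm (h m))\<^sup>2 \<le> r" if h: "h \<in> G" for h
    proof -
      have hm: "h m = (1/2) *\<^sub>R (h p + h q)" and hd: "h (p - q) = h p - h q"
        using lin[OF h] by (simp_all add: m_def linear_add linear_scale linear_diff scaleR_add_right)
      have "(norm (h m))\<^sup>2 = ((norm (h p))\<^sup>2 + (norm (h q))\<^sup>2) / 2 - (norm (h (p - q)))\<^sup>2 / 4"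
        unfolding hm hd power2_norm_eq_inner by (simp add: inner_add inner_diff inner_commute field_simps)
      moreover have "(norm (h p))\<^sup>2 \<le> (n p)\<^sup>2" using le_n[OF h] by (intro power_mono) auto
      moreover have "(norm (h q))\<^sup>2 \<le> (n p)\<^sup>2"
        using order_trans[OF le_n[OF h] nq] by (intro power_mono) auto
      moreover have "(a * norm (p - q))\<^sup>2 \<le> (norm (h (p - q)))\<^sup>2"
        using lb[OF h] a by (intro power_mono) auto
      ultimately show ?thesis unfolding r_def power_mult_distrib by (simp add: field_simps)
    qed
    have "r \<ge> 0" using r[OF g] by (smt (verit) zero_le_power2)
    have "n m \<le> sqrt r" using r by (intro n_le) (simp add: real_le_rsqrt)
    then have "n p \<le> sqrt r" using nm by simp
    moreover have "n p \<ge> 0" using le_n[OF g, of p] norm_ge_zero order_trans by blast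
    ultimately have "(n p)\<^sup>2 \<le> r" using \<open>r \<ge> 0\<close> by (metis power_mono real_sqrt_pow2)
    then have "a\<^sup>2 * (norm (p - q))\<^sup>2 \<le> 0" by (simp add: r_def)
    then have "p = q" using a by (simp add: mult_le_0_iff)
    then show ?thesis by (simp add: q_def)
  qed
  then show ?thesis using p(1) by blast
qed (use K in auto)

text \<open>The fixed point lemma is applied to the linear action
  \<open>M ** Q ** transpose M\<close>, on a compact convex set of uniformly positive definite forms
  that contains the identity.\<close>

lemma invariant_positive_form:
  fixes G :: "(real^'d^'d) set"
  assumes \<kappa>: "\<kappa> > 0" and G: "\<And>M. M \<in> G \<Longrightarrow> quasi_isom \<kappa> M"
    and comp: "\<And>M M'. M \<in> G \<Longrightarrow> M' \<in> G \<Longrightarrow> M' ** M \<in> G" and one: "mat 1 \<in> G"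
  obtains Q where "transpose Q = Q" "op_bound Q (\<kappa>\<^sup>2)" "\<And>v. (norm v)\<^sup>2 \<le> \<kappa>\<^sup>2 * (v \<bullet> (Q *v v))"
    "\<And>M. M \<in> G \<Longrightarrow> M ** Q ** transpose M = Q"
proof -
  define act where "act M Q = M ** Q ** transpose M" for M Q :: "real^'d^'d"
  \<comment> \<open>Quantifying the bounds over all of \<open>G\<close> makes the set invariant
    under the action; \<open>mat 1 \<in> G\<close> turns them into bounds on \<open>Q\<close>
    itself.\<close>
  define K where "K = {Q. transpose Q = Q \<and> (\<forall>M\<in>G. \<forall>v. norm (act M Q *v v) \<le> \<kappa>\<^sup>2 * norm v \<and>
     (norm v)\<^sup>2 \<le> \<kappa>\<^sup>2 * (v \<bullet> (act M Q *v v)))}"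
  have act_mult: "act (M ** M') Q = act M (act M' Q)" for M M' Q
    by (simp add: act_def matrix_transpose_mul matrix_mul_assoc)
  have act_one: "act (mat 1) Q = Q" for Q by (simp add: act_def transpose_mat)
  have lin: "linear (act M)" for M
    by (rule linearI) (simp_all add: act_def matrix_add_ldistrib matrix_add_left matrix_scaleR_left matrix_scaleR_right)
  have sym: "transpose (act M Q) = act M Q" if "transpose Q = Q" for M Q
    using that by (simp add: act_def matrix_transpose_mul matrix_mul_assoc)
  have cont: "continuous_on UNIV (act M)" for M
    unfolding act_def by (intro continuous_on_matrix_mult continuous_on_const continuous_on_id)
  have upper: "norm (act M Q) \<le> \<kappa>\<^sup>2 * norm Q" if "op_bound M \<kappa>" for M Q
  proof -
    have "norm (act M Q) \<le> \<kappa> * norm (M ** Q)"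
      unfolding act_def by (rule norm_mult_le_right[OF op_bound_transpose[OF that]])
    also have "\<dots> \<le> \<kappa> * (\<kappa> * norm Q)" using \<kappa> by (intro mult_left_mono norm_mult_le_left[OF that]) auto
    finally show ?thesis by (simp add: power2_eq_square)
  qed
  \<comment> \<open>The inverse of \<open>M\<close> may lie outside \<open>G\<close>; only its
    operator bound enters.\<close>
  have lower: "1 / \<kappa>\<^sup>2 * norm Q \<le> norm (act M Q)" if M: "M \<in> G" for M Q
  proof -
    obtain M' where M': "M' ** M = mat 1" "op_bound M' \<kappa>" using quasi_isom_inverse[OF G[OF M]] by metis
    have "norm Q = norm (act M' (act M Q))" by (simp add: act_mult[symmetric] M' act_one)
    also have "\<dots> \<le> \<kappa>\<^sup>2 * norm (act M Q)" by (rule upper[OF M'(2)])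
    finally show ?thesis using \<kappa> by (simp add: field_simps)
  qed
  have "closed K"
    unfolding K_def Ball_def
    by (intro closed_Collect_conj closed_Collect_all closed_Collect_imp open_Collect_const
        closed_Collect_eq closed_Collect_le continuous_intros continuous_on_transpose
        continuous_on_matrix_vector_mult cont)
  moreover have "bounded K"
    unfolding bounded_iff
  proof (intro exI ballI)
    fix Q assume "Q \<in> K"
    then have "norm (Q *v v) \<le> \<kappa>\<^sup>2 * norm v" for v using one by (auto simp: K_def act_one)
    then have "mnorm Q \<le> \<kappa>\<^sup>2" unfolding mnorm_def by (rule onorm_le)
    then show "norm Q \<le> real (CARD('d) * CARD('d)) * \<kappa>\<^sup>2"
      using order_trans[OF norm_le_mnorm[of Q]] by (meson mult_left_mono of_nat_0_le_iff)
  qed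
  ultimately have "compact K" by (simp add: compact_eq_bounded_closed)
  moreover have "convex K"
  proof (rule convexI)
    fix P Q and u v :: real assume P: "P \<in> K" and Q: "Q \<in> K" and uv: "u \<ge> 0" "v \<ge> 0" "u + v = 1"
    have eq: "act M (u *\<^sub>R P + v *\<^sub>R Q) *v w = u *\<^sub>R (act M P *v w) + v *\<^sub>R (act M Q *v w)" for M w
      by (simp add: linear_add[OF lin] linear_scale[OF lin] matrix_vector_mult_add_rdistrib scaleR_matrix_vector_assoc)
    have "norm (act M (u *\<^sub>R P + v *\<^sub>R Q) *v w) \<le> \<kappa>\<^sup>2 * norm w"
      "(norm w)\<^sup>2 \<le> \<kappa>\<^sup>2 * (w \<bullet> (act M (u *\<^sub>R P + v *\<^sub>R Q) *v w))" if M: "M \<in> G" for M w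
    proof -
      have 1: "norm (act M P *v w) \<le> \<kappa>\<^sup>2 * norm w" "norm (act M Q *v w) \<le> \<kappa>\<^sup>2 * norm w"
        "(norm w)\<^sup>2 \<le> \<kappa>\<^sup>2 * (w \<bullet> (act M P *v w))" "(norm w)\<^sup>2 \<le> \<kappa>\<^sup>2 * (w \<bullet> (act M Q *v w))"
        using P Q M by (auto simp: K_def)
      have "norm (act M (u *\<^sub>R P + v *\<^sub>R Q) *v w) \<le> u * norm (act M P *v w) + v * norm (act M Q *v w)"
        unfolding eq using uv by (intro order_trans[OF norm_triangle_ineq]) simp
      also have "\<dots> \<le> \<kappa>\<^sup>2 * norm w" using 1 uv by (intro convex_bound_le)
      finally show "norm (act M (u *\<^sub>R P + v *\<^sub>R Q) *v w) \<le> \<kappa>\<^sup>2 * norm w" .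
      have "(norm w)\<^sup>2 = u * (norm w)\<^sup>2 + v * (norm w)\<^sup>2" using uv by (simp add: distrib_right[symmetric])
      also have "\<dots> \<le> u * (\<kappa>\<^sup>2 * (w \<bullet> (act M P *v w))) + v * (\<kappa>\<^sup>2 * (w \<bullet> (act M Q *v w)))"
        using 1 uv by (intro add_mono mult_left_mono)
      also have "\<dots> = \<kappa>\<^sup>2 * (w \<bullet> (act M (u *\<^sub>R P + v *\<^sub>R Q) *v w))"
        unfolding eq by (simp add: inner_add algebra_simps)
      finally show "(norm w)\<^sup>2 \<le> \<kappa>\<^sup>2 * (w \<bullet> (act M (u *\<^sub>R P + v *\<^sub>R Q) *v w))" .
    qed
    moreover have "transpose (u *\<^sub>R P + v *\<^sub>R Q) = u *\<^sub>R P + v *\<^sub>R Q"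
      using P Q by (simp add: K_def transpose_add transpose_scaleR)
    ultimately show "u *\<^sub>R P + v *\<^sub>R Q \<in> K" by (simp add: K_def)
  qed
  moreover have "mat 1 \<in> K"
    unfolding K_def
  proof (intro CollectI conjI ballI allI)
    fix M v assume M: "M \<in> G"
    have qi: "quasi_isom \<kappa> (transpose M)" using quasi_isom_transpose[OF G[OF M]] .
    have eq: "act M (mat 1) *v v = M *v (transpose M *v v)" by (simp only: act_def matrix_mul_rid matrix_vector_mul_assoc)
    have "norm (M *v (transpose M *v v)) \<le> \<kappa> * norm (transpose M *v v)" using G[OF M] by (simp add: quasi_isom_def)
    also have "\<dots> \<le> \<kappa> * (\<kappa> * norm v)" using qi \<kappa> by (intro mult_left_mono) (auto simp: quasi_isom_def)
    finally show "norm (act M (mat 1) *v v) \<le> \<kappa>\<^sup>2 * norm v" by (simp add: eq power2_eq_square)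
    have "norm v \<le> \<kappa> * norm (transpose M *v v)" using qi by (simp add: quasi_isom_def)
    then have "(norm v)\<^sup>2 \<le> (\<kappa> * norm (transpose M *v v))\<^sup>2" by (intro power_mono) auto
    also have "\<dots> = \<kappa>\<^sup>2 * (v \<bullet> (M *v (transpose M *v v)))"
      by (simp add: power_mult_distrib power2_norm_eq_inner inner_matrix_transpose inner_commute[of v])
    finally show "(norm v)\<^sup>2 \<le> \<kappa>\<^sup>2 * (v \<bullet> (act M (mat 1) *v v))" by (simp add: eq)
  qed (simp add: transpose_mat)
  moreover have "act M Q \<in> K" if M: "M \<in> G" and Q: "Q \<in> K" for M Q
    using Q sym comp[OF M] unfolding K_def by (auto simp: act_mult[symmetric])
  moreover have "act M' \<circ> act M \<in> act ` G" if "M \<in> G" "M' \<in> G" for M M'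
    using comp[OF that] by (rule rev_image_eqI) (simp add: fun_eq_iff act_mult)
  ultimately have "\<exists>Q\<in>K. \<forall>g\<in>act ` G. g Q = Q"
    using \<kappa> lin lower upper[OF quasi_isom_op_bound[OF G]]
    by (intro semigroup_common_fixpoint[where a = "1 / \<kappa>\<^sup>2" and b = "\<kappa>\<^sup>2"])
      (auto simp del: o_apply)
  then obtain Q where Q: "Q \<in> K" "\<And>M. M \<in> G \<Longrightarrow> act M Q = Q" by auto
  show thesis
  proof (rule that[of Q])
    show "transpose Q = Q" using Q by (simp add: K_def)
    have "\<And>v. norm (Q *v v) \<le> \<kappa>\<^sup>2 * norm v \<and> (norm v)\<^sup>2 \<le> \<kappa>\<^sup>2 * (v \<bullet> (Q *v v))"
      using Q(1) one unfolding K_def by (auto simp: act_one)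
    then show "op_bound Q (\<kappa>\<^sup>2)" "\<And>v. (norm v)\<^sup>2 \<le> \<kappa>\<^sup>2 * (v \<bullet> (Q *v v))"
      by (auto simp: op_bound_def)
    show "\<And>M. M \<in> G \<Longrightarrow> M ** Q ** transpose M = Q" using Q(2) by (simp add: act_def)
  qed
qed

subsection \<open>Square roots\<close>

text \<open>The solution \<open>Y\<close> of \<open>2 Y = X + Y\<^sup>2\<close> satisfies \<open>(1 - Y)\<^sup>2 = 1 - X\<close>, and it is the fixed point of
  a contraction as soon as the operator norm of \<open>X\<close> is less than one.\<close>

lemma sq_diff_le:
  assumes "op_bound Y q" "op_bound Z q"
  shows "norm (Y ** Y - Z ** Z) \<le> 2 * q * norm (Y - Z)"
proof -
  have "Y ** Y - Z ** Z = Y ** (Y - Z) + (Y - Z) ** Z"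
    by (simp add: matrix_diff_left matrix_diff_right)
  then have "norm (Y ** Y - Z ** Z) \<le> norm (Y ** (Y - Z)) + norm ((Y - Z) ** Z)"
    by (metis norm_triangle_ineq)
  also have "\<dots> \<le> q * norm (Y - Z) + q * norm (Y - Z)"
    by (intro add_mono norm_mult_le_left norm_mult_le_right assms)
  finally show ?thesis by simp
qed

text \<open>\<open>mat 1 - sqrt_defect q X\<close> is the square root of \<open>mat 1 - X\<close>.
  The bound \<open>q\<close> singles out one solution, and the symmetry of the root is later read
  off from this uniqueness.\<close>

definition sqrt_defect :: "real \<Rightarrow> real^'d^'d \<Rightarrow> real^'d^'d" where
  "sqrt_defect q X = (THE Y. op_bound Y q \<and> (1/2) *\<^sub>R (X + Y ** Y) = Y)"

lemma closed_op_bound: "closed {Y. op_bound Y q}"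
  unfolding op_bound_def
  by (intro closed_Collect_all closed_Collect_le continuous_intros continuous_on_matrix_vector_mult)

text \<open>The set with operator bound \<open>q\<close> is mapped to itself because
  \<open>(q + q * q) / 2 \<le> q\<close>; on it the map contracts the Euclidean norm by
  \<open>q\<close>, by \<open>sq_diff_le\<close>.\<close>

lemma sqrt_defect_unique:
  assumes q: "0 \<le> q" "q < 1" and X: "op_bound X q"
  shows "\<exists>!Y. op_bound Y q \<and> (1/2) *\<^sub>R (X + Y ** Y) = Y"
proof -
  have "\<exists>!Y\<in>{Y. op_bound Y q}. (1/2) *\<^sub>R (X + Y ** Y) = Y"
  proof (rule Banach_fix[OF _ _ q])
    show "complete {Y :: real^'a^'a. op_bound Y q}"
      using closed_op_bound complete_eq_closed by blast
    have "op_bound (0 :: real^'a^'a) q" using q by (simp add: op_bound_def)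
    then show "{Y :: real^'a^'a. op_bound Y q} \<noteq> {}" by blast
    show "(\<lambda>Y. (1/2) *\<^sub>R (X + Y ** Y)) ` {Y. op_bound Y q} \<subseteq> {Y. op_bound Y q}"
    proof clarify
      fix Y :: "real^'a^'a" assume Y: "op_bound Y q"
      have YY: "op_bound (Y ** Y) (q * q)" using Y q by (intro op_bound_mult)
      have "norm ((1/2) *\<^sub>R (X + Y ** Y) *v v) \<le> q * norm v" for v
      proof -
        have "norm ((1/2) *\<^sub>R (X + Y ** Y) *v v) = (1/2) * norm (X *v v + (Y ** Y) *v v)"
          by (simp add: scaleR_matrix_vector_assoc[symmetric] matrix_vector_mult_add_rdistrib)
        also have "\<dots> \<le> (1/2) * (q * norm v + q * q * norm v)"
          using X YY by (intro mult_left_mono order_trans[OF norm_triangle_ineq] add_mono) (auto simp: op_bound_def)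
        also have "\<dots> \<le> (1/2) * (q * norm v + q * 1 * norm v)"
          using q by (intro mult_left_mono add_mono mult_right_mono) auto
        finally show ?thesis by simp
      qed
      then show "op_bound ((1/2) *\<^sub>R (X + Y ** Y)) q" by (simp add: op_bound_def)
    qed
    show "dist ((1/2) *\<^sub>R (X + Y ** Y)) ((1/2) *\<^sub>R (X + Z ** Z)) \<le> q * dist Y Z"
      if "Y \<in> {Y. op_bound Y q}" "Z \<in> {Y. op_bound Y q}" for Y Z :: "real^'a^'a"
      using sq_diff_le[of Y q Z] that by (simp add: dist_norm scaleR_diff_right[symmetric] del: scaleR_diff_right)
  qed
  then show ?thesis by auto
qed

lemma sqrt_defect:
  assumes "0 \<le> q" "q < 1" "op_bound X q"
  shows "op_bound (sqrt_defect q X) q"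
    "(1/2) *\<^sub>R (X + sqrt_defect q X ** sqrt_defect q X) = sqrt_defect q X"
  using theI'[OF sqrt_defect_unique[OF assms]] unfolding sqrt_defect_def by blast+

text \<open>Subtract the two fixed point equations and absorb the term
  \<open>q * norm (Y - Z)\<close> on the left. This makes the conjugacy continuous.\<close>

lemma sqrt_defect_lipschitz:
  assumes q: "0 \<le> q" "q < 1" and X: "op_bound X q" and X': "op_bound X' q"
  shows "norm (sqrt_defect q X - sqrt_defect q X') \<le> norm (X - X') / (2 * (1 - q))"
proof -
  let ?Y = "sqrt_defect q X" and ?Z = "sqrt_defect q X'"
  note Y = sqrt_defect[OF q X] and Z = sqrt_defect[OF q X']
  have "?Y - ?Z = (1/2) *\<^sub>R ((X - X') + (?Y ** ?Y - ?Z ** ?Z))"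
    by (subst (1) Y(2)[symmetric], subst (1) Z(2)[symmetric]) (simp add: algebra_simps)
  then have "norm (?Y - ?Z) = (1/2) * norm ((X - X') + (?Y ** ?Y - ?Z ** ?Z))" by simp
  also have "\<dots> \<le> (1/2) * (norm (X - X') + 2 * q * norm (?Y - ?Z))"
    by (intro mult_left_mono order_trans[OF norm_triangle_ineq] add_mono sq_diff_le Y Z) auto
  finally show ?thesis using q by (simp add: field_simps)
qed

lemma sqrt_defect_square:
  assumes "0 \<le> q" "q < 1" "op_bound X q"
  shows "(mat 1 - sqrt_defect q X) ** (mat 1 - sqrt_defect q X) = mat 1 - X"
proof -
  let ?Y = "sqrt_defect q X"
  have "2 *\<^sub>R ?Y = X + ?Y ** ?Y"
    using arg_cong[OF sqrt_defect(2)[OF assms], of "\<lambda>M. 2 *\<^sub>R M"] by simp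
  then show ?thesis
    by (simp add: matrix_diff_left matrix_diff_right algebra_simps scaleR_2)
qed

lemma sqrt_defect_transpose:
  assumes "0 \<le> q" "q < 1" "op_bound X q" "transpose X = X"
  shows "transpose (sqrt_defect q X) = sqrt_defect q X"
proof -
  let ?Y = "sqrt_defect q X"
  note Y = sqrt_defect[OF assms(1-3)]
  have "(1/2) *\<^sub>R (X + transpose ?Y ** transpose ?Y) = transpose ?Y"
    using arg_cong[OF Y(2), of transpose] assms(4)
    by (simp add: transpose_scaleR transpose_add matrix_transpose_mul)
  then show ?thesis
    using sqrt_defect_unique[OF assms(1-3)] Y op_bound_transpose[OF Y(1)] by blast
qed

lemma sqrt_defect_invertible:
  assumes "0 \<le> q" "q < 1" "op_bound X q"
  shows "invertible (mat 1 - sqrt_defect q X)"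
proof -
  have "v = 0" if "(mat 1 - sqrt_defect q X) *v v = 0" for v
  proof -
    have "v = sqrt_defect q X *v v" using that by (simp add: matrix_vector_mult_diff_rdistrib)
    then have "norm v \<le> q * norm v" using sqrt_defect(1)[OF assms] unfolding op_bound_def by metis
    then have "(1 - q) * norm v \<le> 0" by (simp add: algebra_simps)
    then show "v = 0" using assms(2) by (simp add: mult_le_0_iff)
  qed
  then have "inj ((*v) (mat 1 - sqrt_defect q X))" unfolding vec.inj_iff_eq_0 by blast
  then show ?thesis by (simp add: invertible_left_inverse matrix_left_invertible_injective)
qed

text \<open>Bounds the operator norm by the quadratic form without eigenvalues, by testing
  positivity at one well-chosen vector.\<close>

lemma positive_symmetric_op_bound:
  assumes sym: "transpose X = X" and q: "q > 0"
    and X: "\<And>v. 0 \<le> v \<bullet> (X *v v)" "\<And>v. v \<bullet> (X *v v) \<le> q * (norm v)\<^sup>2"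
  shows "op_bound X q"
  unfolding op_bound_def
proof
  fix v
  define w where "w = X *v v"
  have wv: "w \<bullet> w = v \<bullet> (X *v w)" "w \<bullet> w = w \<bullet> (X *v v)"
    using inner_matrix_transpose[of X v w] sym by (simp_all add: w_def)
  \<comment> \<open>The step \<open>1/q\<close> minimises the resulting upper bound, which becomes
    \<open>q * (norm v)\<^sup>2 - (norm w)\<^sup>2 / q\<close>.\<close>
  define u where "u = v - (1/q) *\<^sub>R w"
  have "0 \<le> u \<bullet> (X *v u)" by (rule X(1))
  also have "u \<bullet> (X *v u) = v \<bullet> (X *v v) - (2/q) * (w \<bullet> w) + (1/q)\<^sup>2 * (w \<bullet> (X *v w))"
    unfolding u_def matrix_vector_mult_diff_distrib matrix_vector_mult_scaleR inner_diff inner_scaleR_left inner_scaleR_right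
    using wv by (simp add: power2_eq_square algebra_simps)
  also have "\<dots> \<le> q * (norm v)\<^sup>2 - (2/q) * (w \<bullet> w) + (1/q)\<^sup>2 * (q * (norm w)\<^sup>2)"
    using q by (intro add_mono diff_mono mult_left_mono X) auto
  also have "\<dots> = q * (norm v)\<^sup>2 - (norm w)\<^sup>2 / q"
    using q by (simp add: power2_norm_eq_inner[symmetric] power2_eq_square field_simps)
  finally have "(norm w)\<^sup>2 \<le> (q * norm v)\<^sup>2"
    using q by (simp add: field_simps power2_eq_square)
  then show "norm (X *v v) \<le> q * norm v" using q by (simp add: w_def power2_le_iff_abs_le)
qed

text \<open>Multiplying by the transpose produces \<open>A ** Q ** transpose A = P' ** P'\<close> in
  the middle, and the outer inverses of the symmetric \<open>P'\<close> cancel it.\<close>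

lemma orthogonal_conjugate:
  fixes A P P' Q Q' :: "real^'d^'d"
  assumes P: "transpose P = P" "P ** P = Q" and P': "transpose P' = P'" "P' ** P' = Q'" "invertible P'"
    and A: "A ** Q ** transpose A = Q'"
  shows "orthogonal_matrix (matrix_inv P' ** A ** P)"
proof -
  let ?I = "matrix_inv P'"
  have I: "?I ** P' = mat 1"
    using P'(3) someI_ex[of "\<lambda>M. P' ** M = mat 1 \<and> M ** P' = mat 1"]
    by (simp add: invertible_def matrix_inv_def)
  then have I': "P' ** transpose ?I = mat 1" by (metis matrix_transpose_mul P'(1) transpose_mat)
  have "(?I ** A ** P) ** transpose (?I ** A ** P) = ?I ** (A ** (P ** P) ** transpose A) ** transpose ?I"
    by (simp add: matrix_transpose_mul P(1) matrix_mul_assoc)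
  also have "\<dots> = (?I ** P') ** (P' ** transpose ?I)"
    unfolding P(2) A P'(2)[symmetric] by (simp add: matrix_mul_assoc)
  finally show ?thesis using I I' by (simp add: orthogonal_matrix_def matrix_left_right_inverse)
qed

subsection \<open>Cocycles\<close>

lemma cocp_add: "cocp A (m + n) x = cocp A m (shiftn (int n) x) ** cocp A n x"
  by (induction m) (simp_all add: shiftn_add matrix_mul_assoc)

lemma closed_quasi_isom: "closed {M :: real^'d^'d. quasi_isom \<kappa> M}"
  unfolding quasi_isom_def
  by (intro closed_Collect_all closed_Collect_conj closed_Collect_le continuous_intros
      continuous_on_matrix_vector_mult)

lemma quasi_isom_norm_le:
  assumes "quasi_isom \<kappa> (M :: real^'d^'d)"
  shows "norm M \<le> real (CARD('d) * CARD('d)) * \<kappa>"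
proof -
  have "mnorm M \<le> \<kappa>" unfolding mnorm_def using assms by (intro onorm_le) (simp add: quasi_isom_def)
  then show ?thesis using order_trans[OF norm_le_mnorm[of M]] by (meson mult_left_mono of_nat_0_le_iff)
qed

text \<open>Only forward products are assumed bounded, but at every point of the subshift;
  \<open>quasi_isom\<close> controls their inverses too.\<close>

locale bounded_cocycle =
  fixes N :: nat and H :: "nat \<Rightarrow> nat \<Rightarrow> bool" and A :: "seq \<Rightarrow> real^'d^'d" and \<kappa> \<alpha> C :: real
  assumes transitive: "transitive_shift (SFT N H)"
    and \<alpha>: "\<alpha> > 0" and C: "C \<ge> 0" and \<kappa>: "\<kappa> \<ge> 1"
    and holder: "\<And>x y. x \<in> SFT N H \<Longrightarrow> y \<in> SFT N H \<Longrightarrow> norm (A x - A y) \<le> C * sdist x y powr \<alpha>"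
    and bounded: "\<And>x n. x \<in> SFT N H \<Longrightarrow> quasi_isom \<kappa> (cocp A n x)"
begin

text \<open>The factor gained in the Hoelder estimate when the window of agreement grows by
  one.\<close>

definition \<rho> :: real where "\<rho> = (1/2) powr \<alpha>"

lemma \<rho>: "0 < \<rho>" "\<rho> < 1"
  using \<alpha> by (simp_all add: \<rho>_def powr01_less_one)

lemma holder_agree:
  assumes "x \<in> SFT N H" "y \<in> SFT N H" "agree K x y"
  shows "norm (A x - A y) \<le> C * \<rho> ^ K"
proof -
  have "sdist x y \<le> (1/2) ^ K"
    using agree_imp_sdist_le[OF assms(3)] by (rule order_trans) simp
  then have "sdist x y powr \<alpha> \<le> ((1/2) ^ K) powr \<alpha>"
    using \<alpha> sdist_nonneg by (intro powr_mono2) auto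
  also have "\<dots> = \<rho> ^ K"
    unfolding \<rho>_def by (simp add: powr_realpow[symmetric] powr_powr mult.commute)
  finally have "C * sdist x y powr \<alpha> \<le> C * \<rho> ^ K" using C by (intro mult_left_mono)
  then show ?thesis using holder[OF assms(1,2)] by linarith
qed

text \<open>Telescoping: one factor is exchanged at a time, and the products on both sides of it are
  bounded by \<open>\<kappa>\<close>, so the error does not grow with the length.\<close>

lemma cocp_diff_le:
  assumes x: "x \<in> SFT N H" and y: "y \<in> SFT N H"
    and ag: "\<And>j. j < n \<Longrightarrow> agree (e j) (shiftn (int j) x) (shiftn (int j) y)"
  shows "norm (cocp A n x - cocp A n y) \<le> (\<Sum>j<n. \<kappa>\<^sup>2 * (C * \<rho> ^ e j))"
proof -
  \<comment> \<open>The first \<open>j\<close> factors follow \<open>y\<close>, the remaining ones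
    follow \<open>x\<close>.\<close>
  define D where "D j = cocp A (n - j) (shiftn (int j) x) ** cocp A j y" for j
  have step: "norm (D j - D (Suc j)) \<le> \<kappa>\<^sup>2 * (C * \<rho> ^ e j)" if j: "j < n" for j
  proof -
    define B where "B = cocp A (n - Suc j) (shiftn (int (Suc j)) x)"
    let ?B' = "cocp A j y"
    have "cocp A (n - j) (shiftn (int j) x) = B ** A (shiftn (int j) x)"
      using cocp_add[of A "n - Suc j" "Suc 0" "shiftn (int j) x"] j
      by (simp add: B_def shiftn_add Suc_diff_Suc)
    then have "D j - D (Suc j) = B ** (A (shiftn (int j) x) - A (shiftn (int j) y)) ** ?B'"
      by (simp add: D_def B_def matrix_diff_left matrix_diff_right matrix_mul_assoc)
    also have "norm \<dots> \<le> \<kappa> * norm (B ** (A (shiftn (int j) x) - A (shiftn (int j) y)))"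
      by (intro norm_mult_le_right quasi_isom_op_bound bounded y)
    also have "\<dots> \<le> \<kappa> * (\<kappa> * norm (A (shiftn (int j) x) - A (shiftn (int j) y)))"
      unfolding B_def using \<kappa>
      by (intro mult_left_mono norm_mult_le_left quasi_isom_op_bound bounded SFT_shiftn x) auto
    also have "\<dots> \<le> \<kappa> * (\<kappa> * (C * \<rho> ^ e j))"
      using \<kappa> by (intro mult_left_mono holder_agree SFT_shiftn x y ag j) auto
    finally show ?thesis by (simp add: power2_eq_square)
  qed
  have "cocp A n x - cocp A n y = D 0 - D n" by (simp add: D_def)
  also have "\<dots> = (\<Sum>j<n. D j - D (Suc j))" by (rule sum_lessThan_telescope'[symmetric])
  also have "norm \<dots> \<le> (\<Sum>j<n. \<kappa>\<^sup>2 * (C * \<rho> ^ e j))"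
    using step by (intro sum_norm_le) auto
  finally show ?thesis .
qed

definition shadow_const :: real where "shadow_const = \<kappa>\<^sup>2 * C / (1 - \<rho>)"

lemma geometric_le: "(\<Sum>j<n. \<kappa>\<^sup>2 * (C * \<rho> ^ (K + j))) \<le> shadow_const * \<rho> ^ K"
proof -
  have "(\<Sum>j<n. \<rho> ^ j) \<le> 1 / (1 - \<rho>)"
    using \<rho> by (simp add: sum_gp_strict field_simps)
  then have "\<kappa>\<^sup>2 * C * \<rho> ^ K * (\<Sum>j<n. \<rho> ^ j) \<le> \<kappa>\<^sup>2 * C * \<rho> ^ K * (1 / (1 - \<rho>))"
    using C \<rho> by (intro mult_left_mono) auto
  then show ?thesis by (simp add: shadow_const_def power_add sum_distrib_left mult_ac)
qed

text \<open>Meant for points that share all letters from index \<open>- K\<close> on: agreement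
  improves with time, so the errors sum geometrically to a bound independent of
  \<open>n\<close>.\<close>

lemma shadow_forward:
  assumes "x \<in> SFT N H" "y \<in> SFT N H"
    "\<And>j. j < n \<Longrightarrow> agree (K + j) (shiftn (int j) x) (shiftn (int j) y)"
  shows "norm (cocp A n x - cocp A n y) \<le> shadow_const * \<rho> ^ K"
  using order_trans[OF cocp_diff_le[OF assms] geometric_le] .

text \<open>The mirror image, for points that share all letters before index \<open>n + K\<close>:
  agreement improves with the distance from the end.\<close>

lemma shadow_backward:
  assumes "x \<in> SFT N H" "y \<in> SFT N H"
    "\<And>j. j < n \<Longrightarrow> agree (K + (n - Suc j)) (shiftn (int j) x) (shiftn (int j) y)"
  shows "norm (cocp A n x - cocp A n y) \<le> shadow_const * \<rho> ^ K"
proof -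
  have "norm (cocp A n x - cocp A n y) \<le> (\<Sum>j<n. \<kappa>\<^sup>2 * (C * \<rho> ^ (K + (n - Suc j))))"
    by (rule cocp_diff_le[OF assms])
  also have "\<dots> = (\<Sum>j<n. \<kappa>\<^sup>2 * (C * \<rho> ^ (K + j)))" by (rule sum.nat_diff_reindex)
  also have "\<dots> \<le> shadow_const * \<rho> ^ K" by (rule geometric_le)
  finally show ?thesis .
qed

text \<open>This is the set \<open>T(x, y)\<close>. The limit is phrased by one window and one
  error, so that membership can be checked on a single glued segment; \<open>n = 0\<close> puts the
  identity into \<open>T(x, x)\<close>.\<close>

definition transport :: "seq \<Rightarrow> seq \<Rightarrow> (real^'d^'d) set" where
  "transport x y = {M. \<forall>K. \<forall>e>0. \<exists>z\<in>SFT N H. \<exists>n. agree K z x \<and>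
     agree K (shiftn (int n) z) y \<and> norm (cocp A n z - M) < e}"

lemma transportE:
  assumes "M \<in> transport x y" "e > 0"
  obtains z n where "z \<in> SFT N H" "agree K z x" "agree K (shiftn (int n) z) y" "norm (cocp A n z - M) < e"
  using assms unfolding transport_def by blast

lemma transport_cocp: "x \<in> SFT N H \<Longrightarrow> cocp A n x \<in> transport x (shiftn (int n) x)"
  unfolding transport_def by (auto intro!: bexI[of _ x] exI[of _ n])

lemma transport_quasi_isom:
  assumes "M \<in> transport x y"
  shows "quasi_isom \<kappa> M"
proof -
  have "\<exists>B\<in>{B. quasi_isom \<kappa> B}. dist B M < e" if e: "e > 0" for e
  proof -
    obtain z n where "z \<in> SFT N H" "norm (cocp A n z - M) < e" using transportE[OF assms e] by metis
    then show ?thesis using bounded by (auto simp: dist_norm)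
  qed
  then have "M \<in> closure {B. quasi_isom \<kappa> B}" unfolding closure_approachable by blast
  then show ?thesis using closed_quasi_isom closure_closed by blast
qed

text \<open>A segment from near \<open>x\<close> to near \<open>y\<close> is glued to one from near
  \<open>y\<close> to near \<open>w\<close>. Around the seam both follow \<open>y\<close>, so the
  shadowing bounds make each half of the glued product close to the original one.\<close>

lemma transport_mult:
  assumes M: "M \<in> transport x y" and M': "M' \<in> transport y w"
  shows "M' ** M \<in> transport x w"
  unfolding transport_def
proof (intro CollectI allI impI)
  fix K and e :: real assume e: "e > 0"
  have pos: "\<kappa> + norm M + 1 > 0" using \<kappa> by (simp add: add_nonneg_pos)
  then have "e / (\<kappa> + norm M + 1) > 0" using e by simp
  \<comment> \<open>Each half will be off by at most \<open>2 * \<eta>\<close>, half from gluing and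
    half from the approximation, and the product by at most \<open>\<kappa> + norm M\<close> times
    that.\<close>
  then obtain \<eta> where \<eta>: "\<eta> > 0" and \<eta>_eq: "2 * \<eta> = e / (\<kappa> + norm M + 1)"
    using that[of "e / (\<kappa> + norm M + 1) / 2"] by (metis field_sum_of_halves half_gt_zero mult_2)
  have S: "shadow_const \<ge> 0" using C \<rho> by (simp add: shadow_const_def)
  obtain k where k: "\<rho> ^ k < \<eta> / (shadow_const + 1)"
    using real_arch_pow_inv[of "\<eta> / (shadow_const + 1)" \<rho>] \<rho> \<eta> S by auto
  define K' where "K' = max K k"
  have "\<rho> ^ K' \<le> \<rho> ^ k" using \<rho> by (intro power_decreasing) (auto simp: K'_def)
  then have "shadow_const * \<rho> ^ K' \<le> (shadow_const + 1) * \<rho> ^ k"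
    using S \<rho> by (intro mult_mono) auto
  also have "\<dots> < \<eta>" using k S by (simp add: field_simps)
  finally have small: "shadow_const * \<rho> ^ K' < \<eta>" .
  obtain z n where z: "z \<in> SFT N H" "agree K' z x" "agree K' (shiftn (int n) z) y" "norm (cocp A n z - M) < \<eta>"
    using transportE[OF M \<eta>] .
  obtain z' n' where z': "z' \<in> SFT N H" "agree K' z' y" "agree K' (shiftn (int n') z') w" "norm (cocp A n' z' - M') < \<eta>"
    using transportE[OF M' \<eta>] .
  have zz: "z (i + int n) = z' i" if "\<bar>i\<bar> \<le> int K'" for i
    using z(3) z'(2) that by (simp add: agree_def shiftn_def)
  define u where "u = (\<lambda>i. if i \<le> int n then z i else z' (i - int n))"
  have u: "u \<in> SFT N H" unfolding u_def using z(1) z'(1) zz[of 0] by (intro SFT_glue) auto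
  \<comment> \<open>Since \<open>z\<close> and \<open>z'\<close> coincide on the window around the
    seam, \<open>u\<close> follows either of them \<open>K'\<close> letters past it.\<close>
  have uz: "u i = z i" if "i \<le> int n + int K'" for i
    using zz[of "i - int n"] that by (auto simp: u_def)
  have uz': "u (i + int n) = z' i" if "i \<ge> - int K'" for i
    using zz[of i] that by (auto simp: u_def)
  have "agree K u x" using z(2) uz by (auto simp: agree_def K'_def)
  moreover have "agree K (shiftn (int (n' + n)) u) w"
    unfolding agree_def shiftn_def
  proof (intro allI impI)
    fix i assume i: "\<bar>i\<bar> \<le> int K"
    then have "u (i + int n' + int n) = z' (i + int n')" by (intro uz') (auto simp: K'_def)
    also have "\<dots> = w i" using z'(3) i by (auto simp: agree_def shiftn_def K'_def)
    finally show "u (i + int (n' + n)) = w i" by (simp add: add.assoc)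
  qed
  moreover have "norm (cocp A (n' + n) u - M' ** M) < e"
  proof -
    let ?B = "cocp A n u" and ?B' = "cocp A n' (shiftn (int n) u)"
    have "norm (?B - cocp A n z) \<le> shadow_const * \<rho> ^ K'"
    proof (rule shadow_backward[OF u z(1)])
      fix j assume "j < n"
      then show "agree (K' + (n - Suc j)) (shiftn (int j) u) (shiftn (int j) z)"
        unfolding agree_def shiftn_def by (intro allI impI uz) (auto simp: of_nat_diff)
    qed
    moreover have "norm (?B - M) \<le> norm (?B - cocp A n z) + norm (cocp A n z - M)"
      using norm_triangle_ineq[of "?B - cocp A n z" "cocp A n z - M"] by simp
    ultimately have 1: "norm (?B - M) \<le> 2 * \<eta>" using small z(4) by linarith
    have "norm (?B' - cocp A n' z') \<le> shadow_const * \<rho> ^ K'"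
    proof (rule shadow_forward[OF SFT_shiftn[OF u] z'(1)])
      fix j
      show "agree (K' + j) (shiftn (int j) (shiftn (int n) u)) (shiftn (int j) z')"
        unfolding agree_def shiftn_def by (intro allI impI uz') auto
    qed
    moreover have "norm (?B' - M') \<le> norm (?B' - cocp A n' z') + norm (cocp A n' z' - M')"
      using norm_triangle_ineq[of "?B' - cocp A n' z'" "cocp A n' z' - M'"] by simp
    ultimately have 2: "norm (?B' - M') \<le> 2 * \<eta>" using small z'(4) by linarith
    have "cocp A (n' + n) u - M' ** M = ?B' ** (?B - M) + (?B' - M') ** M"
      by (simp add: cocp_add matrix_diff_left matrix_diff_right)
    also have "norm \<dots> \<le> norm (?B' ** (?B - M)) + norm ((?B' - M') ** M)" by (rule norm_triangle_ineq)
    also have "\<dots> \<le> \<kappa> * norm (?B - M) + norm (?B' - M') * norm M"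
      by (intro add_mono norm_mult_le_left norm_matrix_mult_le quasi_isom_op_bound bounded SFT_shiftn u)
    also have "\<dots> \<le> \<kappa> * (2 * \<eta>) + (2 * \<eta>) * norm M"
      using 1 2 \<kappa> by (intro add_mono mult_left_mono mult_right_mono) auto
    also have "\<dots> = (\<kappa> + norm M) * (2 * \<eta>)" by (simp add: algebra_simps)
    also have "\<dots> < (\<kappa> + norm M + 1) * (2 * \<eta>)" using \<eta> by (intro mult_strict_right_mono) auto
    also note \<eta>_eq
    also have "(\<kappa> + norm M + 1) * (e / (\<kappa> + norm M + 1)) = e" using pos by simp
    finally show ?thesis .
  qed
  ultimately show "\<exists>z\<in>SFT N H. \<exists>n. agree K z x \<and> agree K (shiftn (int n) z) w \<and> norm (cocp A n z - M' ** M) < e"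
    using u by blast
qed

lemma quasi_isom_subseq:
  assumes "\<And>k::nat. quasi_isom \<kappa> (M k :: real^'d^'d)"
  obtains l r where "strict_mono r" "(\<lambda>k. M (r k)) \<longlonglongrightarrow> l"
proof -
  have "bounded (range M)"
    unfolding bounded_iff using quasi_isom_norm_le[OF assms] by auto
  then show thesis using bounded_imp_convergent_subsequence that unfolding o_def by metis
qed

text \<open>The recurrent orbit passes near \<open>x\<close> and later near \<open>y\<close>, for
  every window; the products along these segments are bounded and so have a convergent
  subsequence.\<close>

lemma transport_nonempty:
  assumes x: "x \<in> SFT N H" and y: "y \<in> SFT N H"
  shows "transport x y \<noteq> {}"
proof -
  obtain d where d: "d \<in> SFT N H"
    and dense: "\<And>y K n0. y \<in> SFT N H \<Longrightarrow> \<exists>n\<ge>n0. agree K (shiftn (int n) d) y"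
    using transitive_recurrent[OF transitive] by metis
  have "\<exists>z n. z \<in> SFT N H \<and> agree K z x \<and> agree K (shiftn (int n) z) y" for K
  proof -
    obtain p where p: "agree K (shiftn (int p) d) x" using dense[OF x] by blast
    obtain q where q: "q \<ge> p" "agree K (shiftn (int q) d) y" using dense[OF y] by blast
    have "shiftn (int (q - p)) (shiftn (int p) d) = shiftn (int q) d"
      using q(1) by (simp add: shiftn_add of_nat_diff)
    then show ?thesis using p q d SFT_shiftn by metis
  qed
  then obtain z n where z: "\<And>K. z K \<in> SFT N H" "\<And>K. agree K (z K) x" "\<And>K. agree K (shiftn (int (n K)) (z K)) y"
    by metis
  obtain M r where r: "strict_mono r" "(\<lambda>k. cocp A (n (r k)) (z (r k))) \<longlonglongrightarrow> M"
    using quasi_isom_subseq[of "\<lambda>k. cocp A (n k) (z k)"] bounded[OF z(1)] by blast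
  have "M \<in> transport x y"
    unfolding transport_def
  proof (intro CollectI allI impI)
    fix K and e :: real assume "e > 0"
    then obtain k0 where k0: "\<And>k. k \<ge> k0 \<Longrightarrow> norm (cocp A (n (r k)) (z (r k)) - M) < e"
      using r(2) unfolding LIMSEQ_iff by blast
    define k where "k = max K k0"
    have "K \<le> r k" using seq_suble[OF r(1), of k] by (simp add: k_def)
    then have "agree K (z (r k)) x" "agree K (shiftn (int (n (r k))) (z (r k))) y"
      using z(2,3) agree_mono by blast+
    then show "\<exists>z\<in>SFT N H. \<exists>n. agree K z x \<and> agree K (shiftn (int n) z) y \<and> norm (cocp A n z - M) < e"
      using z(1) k0[of k] by (intro bexI[of _ "z (r k)"] exI[of _ "n (r k)"]) (auto simp: k_def)
  qed
  then show ?thesis by blast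
qed

text \<open>A diagonal choice of segments. It yields continuity of the field of forms although
  transport matrices are chosen arbitrarily.\<close>

lemma transport_closed_graph:
  assumes M: "\<And>k. M k \<in> transport x (y k)" and y: "\<And>k. agree k (y k) w"
    and r: "strict_mono r" "(\<lambda>k. M (r k)) \<longlonglongrightarrow> l"
  shows "l \<in> transport x w"
  unfolding transport_def
proof (intro CollectI allI impI)
  fix K and e :: real assume "e > 0"
  then have e: "e / 2 > 0" by simp
  then obtain k0 where k0: "\<And>k. k \<ge> k0 \<Longrightarrow> norm (M (r k) - l) < e / 2"
    using r(2) unfolding LIMSEQ_iff by blast
  define k where "k = max K k0"
  have "K \<le> r k" using seq_suble[OF r(1), of k] by (simp add: k_def)
  then have yw: "agree K (y (r k)) w" using y agree_mono by blast
  obtain z n where z: "z \<in> SFT N H" "agree K z x" "agree K (shiftn (int n) z) (y (r k))"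
    "norm (cocp A n z - M (r k)) < e / 2" using transportE[OF M e] .
  have "norm (cocp A n z - l) \<le> norm (cocp A n z - M (r k)) + norm (M (r k) - l)"
    using norm_triangle_ineq[of "cocp A n z - M (r k)" "M (r k) - l"] by simp
  also have "\<dots> < e" using z(4) k0[of k] by (simp add: k_def)
  finally show "\<exists>z\<in>SFT N H. \<exists>n. agree K z x \<and> agree K (shiftn (int n) z) w \<and> norm (cocp A n z - l) < e"
    using z agree_trans[OF z(3) yw] by blast
qed

section \<open>The invariant field of forms and the conjugacy\<close>

theorem conj_isometric: "conj_isometric (SFT N H) A"
proof -
  obtain x0 where x0: "x0 \<in> SFT N H" using transitive by (auto simp: transitive_shift_def)
  have one: "mat 1 \<in> transport x0 x0" using transport_cocp[OF x0, of 0] by simp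
  obtain Q0 where Q0: "transpose Q0 = Q0" "op_bound Q0 (\<kappa>\<^sup>2)" "\<And>v. (norm v)\<^sup>2 \<le> \<kappa>\<^sup>2 * (v \<bullet> (Q0 *v v))"
    "\<And>M. M \<in> transport x0 x0 \<Longrightarrow> M ** Q0 ** transpose M = Q0"
  proof (rule invariant_positive_form[of \<kappa> "transport x0 x0"])
    show "\<kappa> > 0" using \<kappa> by simp
    show "quasi_isom \<kappa> M" if "M \<in> transport x0 x0" for M by (rule transport_quasi_isom[OF that])
    show "M' ** M \<in> transport x0 x0" if "M \<in> transport x0 x0" "M' \<in> transport x0 x0" for M M'
      by (rule transport_mult[OF that])
  qed (rule one, rule that)
  define Q where "Q x = (SOME M. M \<in> transport x0 x) ** Q0 ** transpose (SOME M. M \<in> transport x0 x)" for x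
  have some: "(SOME M. M \<in> transport x0 x) \<in> transport x0 x" if "x \<in> SFT N H" for x
    by (rule someI_ex) (use transport_nonempty[OF x0 that] in blast)
  have Q_eq: "Q x = M ** Q0 ** transpose M" if x: "x \<in> SFT N H" and M: "M \<in> transport x0 x" for x M
  proof -
    obtain B where B: "B \<in> transport x x0" using transport_nonempty[OF x x0] by blast
    obtain B' where B': "B' ** B = mat 1" using quasi_isom_inverse[OF transport_quasi_isom[OF B]] by metis
    \<comment> \<open>Returning to \<open>x0\<close> by a fixed \<open>B\<close> puts
      \<open>B ** M\<close> into the semigroup that preserves \<open>Q0\<close>; hence every
      \<open>M\<close> transports \<open>Q0\<close> to the same form, which is determined by
      \<open>B\<close> alone.\<close>
    have *: "M ** Q0 ** transpose M = B' ** Q0 ** transpose B'" if "M \<in> transport x0 x" for M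
    proof -
      have "(B ** M) ** Q0 ** transpose (B ** M) = Q0" by (rule Q0(4)[OF transport_mult[OF that B]])
      then have "B' ** Q0 ** transpose B' = B' ** ((B ** M) ** Q0 ** transpose (B ** M)) ** transpose B'" by simp
      also have "\<dots> = (B' ** B) ** M ** Q0 ** transpose M ** transpose (B' ** B)"
        by (simp add: matrix_transpose_mul matrix_mul_assoc)
      also have "\<dots> = M ** Q0 ** transpose M" by (simp add: B' transpose_mat)
      finally show ?thesis by simp
    qed
    show ?thesis unfolding Q_def *[OF some[OF x]] *[OF M] ..
  qed
  have sym: "transpose (Q x) = Q x" for x
    by (simp add: Q_def matrix_transpose_mul Q0(1) matrix_mul_assoc)
  \<comment> \<open>\<open>Q0\<close> contributes \<open>\<kappa>\<^sup>2\<close>, and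
    \<open>transpose M\<close>, which enters the form twice, another
    \<open>\<kappa>\<^sup>2\<close>.\<close>
  have Q_bounds: "v \<bullet> (Q x *v v) \<le> \<kappa> ^ 4 * (norm v)\<^sup>2" "(norm v)\<^sup>2 \<le> \<kappa> ^ 4 * (v \<bullet> (Q x *v v))"
    if x: "x \<in> SFT N H" for x v
  proof -
    obtain M where M: "M \<in> transport x0 x" using transport_nonempty[OF x0 x] by blast
    have qi: "quasi_isom \<kappa> (transpose M)" using quasi_isom_transpose[OF transport_quasi_isom[OF M]] .
    define w where "w = transpose M *v v"
    have "Q x *v v = M *v (Q0 *v w)"
      by (simp only: Q_eq[OF x M] w_def matrix_vector_mul_assoc matrix_mul_assoc)
    then have eq: "v \<bullet> (Q x *v v) = w \<bullet> (Q0 *v w)"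
      using inner_matrix_transpose[of M "Q0 *v w" v] by (simp only: w_def[symmetric] inner_commute)
    have w: "norm w \<le> \<kappa> * norm v" "norm v \<le> \<kappa> * norm w" using qi by (auto simp: quasi_isom_def w_def)
    have "w \<bullet> (Q0 *v w) \<le> norm w * norm (Q0 *v w)" by (rule norm_cauchy_schwarz)
    also have "\<dots> \<le> norm w * (\<kappa>\<^sup>2 * norm w)" using Q0(2) by (intro mult_left_mono) (auto simp: op_bound_def)
    also have "\<dots> = \<kappa>\<^sup>2 * (norm w)\<^sup>2" by (simp add: power2_eq_square)
    also have "\<dots> \<le> \<kappa>\<^sup>2 * (\<kappa> * norm v)\<^sup>2" using w by (intro mult_left_mono power_mono) auto
    also have "\<dots> = \<kappa> ^ 4 * (norm v)\<^sup>2" by (simp add: power_mult_distrib power2_eq_square power4_eq_xxxx)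
    finally show "v \<bullet> (Q x *v v) \<le> \<kappa> ^ 4 * (norm v)\<^sup>2" by (simp add: eq)
    have "(norm v)\<^sup>2 \<le> (\<kappa> * norm w)\<^sup>2" using w by (intro power_mono) auto
    also have "\<dots> = \<kappa>\<^sup>2 * (norm w)\<^sup>2" by (simp add: power_mult_distrib)
    also have "\<dots> \<le> \<kappa>\<^sup>2 * (\<kappa>\<^sup>2 * (w \<bullet> (Q0 *v w)))" by (intro mult_left_mono Q0(3)) auto
    also have "\<dots> = \<kappa> ^ 4 * (v \<bullet> (Q x *v v))" by (simp add: eq power2_eq_square power4_eq_xxxx)
    finally show "(norm v)\<^sup>2 \<le> \<kappa> ^ 4 * (v \<bullet> (Q x *v v))" .
  qed
  have Q_inv: "A x ** Q x ** transpose (A x) = Q (shift x)" if x: "x \<in> SFT N H" for x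
  proof -
    obtain M where M: "M \<in> transport x0 x" using transport_nonempty[OF x0 x] by blast
    have "A x \<in> transport x (shift x)" using transport_cocp[OF x, of 1] by (simp add: shiftn_1)
    then have "A x ** M \<in> transport x0 (shift x)" by (rule transport_mult[OF M])
    then have "Q (shift x) = (A x ** M) ** Q0 ** transpose (A x ** M)"
      using SFT_shiftn[OF x, of 1] by (intro Q_eq) (simp_all add: shiftn_1)
    then show ?thesis by (simp add: Q_eq[OF x M] matrix_transpose_mul matrix_mul_assoc)
  qed
  \<comment> \<open>Along a sequence violating continuity, transport matrices subconverge to a
    member of \<open>transport x0 x\<close>, and that member computes \<open>Q x\<close>.\<close>
  have Q_cont: "\<exists>K. \<forall>y\<in>SFT N H. agree K y x \<longrightarrow> norm (Q y - Q x) < e" if x: "x \<in> SFT N H" and e: "e > 0" for x e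
  proof (rule ccontr)
    assume "\<not> ?thesis"
    then obtain y where y: "\<And>K. y K \<in> SFT N H" "\<And>K. agree K (y K) x" "\<And>K. \<not> norm (Q (y K) - Q x) < e"
      by metis
    have "\<exists>M. M \<in> transport x0 (y K)" for K using transport_nonempty[OF x0 y(1)] by blast
    then obtain M where M: "\<And>K. M K \<in> transport x0 (y K)" by metis
    obtain l r where r: "strict_mono r" "(\<lambda>k. M (r k)) \<longlonglongrightarrow> l"
      using quasi_isom_subseq[of M] transport_quasi_isom[OF M] by blast
    have l: "l \<in> transport x0 x" by (rule transport_closed_graph[OF M y(2) r])
    have "(\<lambda>k. transpose (M (r k))) \<longlonglongrightarrow> transpose l"
      using isCont_tendsto_compose[OF _ r(2), of transpose] continuous_on_transpose[OF continuous_on_id, of UNIV]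
      by (auto simp: continuous_on_eq_continuous_at)
    then have "(\<lambda>k. M (r k) ** Q0 ** transpose (M (r k))) \<longlonglongrightarrow> l ** Q0 ** transpose l"
      by (intro tendsto_matrix_mult tendsto_const r(2))
    then have "(\<lambda>k. Q (y (r k))) \<longlonglongrightarrow> Q x" by (simp add: Q_eq[OF y(1) M] Q_eq[OF x l])
    then show False using e y(3) unfolding LIMSEQ_iff by blast
  qed
  \<comment> \<open>Scaled by \<open>s\<close>, the form lies between \<open>s\<^sup>2\<close> and 1
    times the identity, so \<open>X\<close> below lies between 0 and \<open>1 - s\<^sup>2\<close>.
    Halving in \<open>q\<close> keeps it positive also for \<open>s = 1\<close>.\<close>
  define s where "s = 1 / \<kappa> ^ 4"
  define q where "q = 1 - s\<^sup>2 / 2"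
  have s: "0 < s" "s \<le> 1" using \<kappa> by (auto simp: s_def one_le_power)
  have q: "0 < q" "q < 1" using s power_le_one[of s 2] by (auto simp: q_def)
  define X where "X x = mat 1 - s *\<^sub>R Q x" for x
  have Xq: "op_bound (X x) q" if x: "x \<in> SFT N H" for x
  proof (rule positive_symmetric_op_bound[OF _ q(1)])
    show "transpose (X x) = X x" by (simp add: X_def transpose_diff transpose_mat transpose_scaleR sym)
    fix v
    have eq: "v \<bullet> (X x *v v) = (norm v)\<^sup>2 - s * (v \<bullet> (Q x *v v))"
      by (simp add: X_def matrix_vector_mult_diff_rdistrib scaleR_matrix_vector_assoc[symmetric] inner_diff power2_norm_eq_inner)
    have "s * (v \<bullet> (Q x *v v)) \<le> s * (\<kappa> ^ 4 * (norm v)\<^sup>2)" using s Q_bounds[OF x] by (intro mult_left_mono) auto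
    then show "0 \<le> v \<bullet> (X x *v v)" using \<kappa> by (simp add: eq s_def)
    have "s\<^sup>2 * (norm v)\<^sup>2 \<le> s\<^sup>2 * (\<kappa> ^ 4 * (v \<bullet> (Q x *v v)))" using Q_bounds[OF x] by (intro mult_left_mono) auto
    also have "\<dots> = s * (s * \<kappa> ^ 4) * (v \<bullet> (Q x *v v))" by (simp only: power2_eq_square mult_ac)
    also have "s * \<kappa> ^ 4 = 1" using \<kappa> by (simp add: s_def)
    also have "s * 1 * (v \<bullet> (Q x *v v)) = s * (v \<bullet> (Q x *v v))" by simp
    finally have "s\<^sup>2 * (norm v)\<^sup>2 \<le> s * (v \<bullet> (Q x *v v))" .
    moreover have "0 \<le> s\<^sup>2 * (norm v)\<^sup>2" by simp
    ultimately have "s\<^sup>2 * (norm v)\<^sup>2 / 2 \<le> s * (v \<bullet> (Q x *v v))" by linarith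
    then show "v \<bullet> (X x *v v) \<le> q * (norm v)\<^sup>2" by (simp add: eq q_def left_diff_distrib)
  qed
  have q0: "0 \<le> q" using q by simp
  define P where "P x = mat 1 - sqrt_defect q (X x)" for x
  have Psq: "P x ** P x = s *\<^sub>R Q x" if "x \<in> SFT N H" for x
    using sqrt_defect_square[OF q0 q(2) Xq[OF that]] by (simp add: P_def X_def)
  have Psym: "transpose (P x) = P x" if "x \<in> SFT N H" for x
    using sqrt_defect_transpose[OF q0 q(2) Xq[OF that]]
    by (simp add: P_def X_def transpose_diff transpose_mat transpose_scaleR sym)
  have Pinv: "invertible (P x)" if "x \<in> SFT N H" for x
    using sqrt_defect_invertible[OF q0 q(2) Xq[OF that]] by (simp add: P_def)
  have "scont (SFT N H) P"
    unfolding scont_def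
  proof (intro ballI allI impI)
    fix x and e :: real assume x: "x \<in> SFT N H" and e: "e > 0"
    have e': "e * (2 * (1 - q)) > 0" using e q by simp
    obtain K where K: "\<And>y. y \<in> SFT N H \<Longrightarrow> agree K y x \<Longrightarrow> norm (Q y - Q x) < e * (2 * (1 - q))"
      using Q_cont[OF x e'] by blast
    have "mnorm (P y - P x) < e" if y: "y \<in> SFT N H" "sdist x y < (1/2) ^ K" for y
    proof -
      have yx: "agree K y x" using sdist_less_imp_agree[OF y(2)] by (rule agree_sym)
      have "mnorm (P y - P x) \<le> norm (P y - P x)" by (rule mnorm_le_norm)
      also have "\<dots> = norm (sqrt_defect q (X y) - sqrt_defect q (X x))"
        by (simp add: P_def norm_minus_commute)
      also have "\<dots> \<le> norm (X y - X x) / (2 * (1 - q))"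
        by (rule sqrt_defect_lipschitz[OF q0 q(2) Xq[OF y(1)] Xq[OF x]])
      also have "X y - X x = s *\<^sub>R (Q x - Q y)" by (simp add: X_def algebra_simps)
      also have "norm (s *\<^sub>R (Q x - Q y)) / (2 * (1 - q)) \<le> norm (Q y - Q x) / (2 * (1 - q))"
        using s q by (intro divide_right_mono) (auto simp: norm_minus_commute mult_left_le_one_le)
      also have "\<dots> < e" using K[OF y(1) yx] q by (simp add: field_simps)
      finally show ?thesis .
    qed
    then show "\<exists>\<delta>>0. \<forall>y\<in>SFT N H. sdist x y < \<delta> \<longrightarrow> mnorm (P y - P x) < e"
      by (intro exI[of _ "(1/2) ^ K"]) auto
  qed
  then have "GL_cocycle (SFT N H) P" using Pinv by (simp add: GL_cocycle_def)
  moreover have "orthogonal_matrix (matrix_inv (P (shift x)) ** A x ** P x)" if x: "x \<in> SFT N H" for x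
  proof -
    have sx: "shift x \<in> SFT N H" using SFT_shiftn[OF x, of 1] by (simp add: shiftn_1)
    have "A x ** (s *\<^sub>R Q x) ** transpose (A x) = s *\<^sub>R Q (shift x)"
      using Q_inv[OF x] by (simp add: matrix_scaleR_left matrix_scaleR_right)
    then show ?thesis
      by (rule orthogonal_conjugate[OF Psym[OF x] Psq[OF x] Psym[OF sx] Psq[OF sx] Pinv[OF sx]])
  qed
  ultimately show ?thesis unfolding conj_isometric_def by blast
qed

end

subsection \<open>Uniform bounds from large entropy\<close>

lemma open_coordinates: "open {x :: seq. R (x i) (x j)}"
proof -
  have "{x :: seq. R (x i) (x j)} = (\<Union>(a, b)\<in>{(a, b). R a b}. (\<lambda>x. x i) -` {a} \<inter> (\<lambda>x. x j) -` {b})"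
    by auto
  moreover have "open ((\<lambda>x :: seq. x k) -` {a})" for k a
    by (rule open_vimage) (auto simp: open_discrete intro!: continuous_intros)
  then have "open (\<Union>(a, b)\<in>{(a, b). R a b}. (\<lambda>x :: seq. x i) -` {a} \<inter> (\<lambda>x. x j) -` {b})"
    by (intro open_UN) auto
  ultimately show ?thesis by simp
qed

text \<open>Tychonoff: the function type carries the product topology of discrete factors, and every
  transition is a closed condition on two coordinates.\<close>

lemma compact_SFT: "compact (SFT N H)"
proof -
  have "compactin (product_topology (\<lambda>i::int. euclidean :: nat topology) UNIV) (PiE UNIV (\<lambda>_. {1..N}))"
    unfolding compactin_PiE by (simp add: finite_imp_compact)
  then have "compact (PiE UNIV (\<lambda>_. {1..N}) :: seq set)"
    by (simp add: euclidean_product_topology)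
  moreover have "closed {x :: seq. x i \<in> {1..N} \<and> H (x i) (x (i + 1))}" for i
    using open_coordinates[of "\<lambda>a b. \<not> (a \<in> {1..N} \<and> H a b)" i "i + 1"]
    unfolding closed_def Collect_neg_eq[symmetric] .
  then have "closed (SFT N H)" unfolding SFT_def by (rule closed_Collect_all)
  moreover have "SFT N H \<subseteq> PiE UNIV (\<lambda>_. {1..N})" by (auto simp: SFT_def)
  ultimately show ?thesis using compact_Int_closed[of "PiE UNIV (\<lambda>_. {1..N})" "SFT N H"]
    by (simp add: Int_absorb1)
qed

lemma open_agree: "open {y. agree K y x}"
proof -
  have "{y. agree K y x} = (\<Inter>i\<in>{- int K..int K}. {y. y i = x i})"
    by (auto simp: agree_def abs_le_iff)
  moreover have "open {y :: seq. y i = x i}" for i using open_coordinates[of "\<lambda>a b. a = x i" i i] .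
  ultimately show ?thesis by (auto intro!: open_INT)
qed

lemma scont_agree:
  assumes "scont (SFT N H) f" "x \<in> SFT N H" "e > 0"
  shows "\<exists>K. \<forall>y\<in>SFT N H. agree K y x \<longrightarrow> mnorm (f y - f x) < e"
proof -
  obtain \<delta> where \<delta>: "\<delta> > 0" "\<And>y. y \<in> SFT N H \<Longrightarrow> sdist x y < \<delta> \<Longrightarrow> mnorm (f y - f x) < e"
    using assms unfolding scont_def by blast
  obtain K where K: "(1/2) ^ K < \<delta>" using half_power_less[OF \<delta>(1)] by blast
  have "sdist x y < \<delta>" if "agree K y x" for y
  proof -
    have "sdist x y \<le> (1/2) ^ Suc K" using agree_imp_sdist_le[OF agree_sym[OF that]] .
    also have "\<dots> \<le> (1/2) ^ K" by simp
    finally show ?thesis using K by simp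
  qed
  then show ?thesis using \<delta>(2) by blast
qed

text \<open>Needed because \<open>dC0\<close> is a real supremum, which controls pointwise
  differences only for families bounded above.\<close>

lemma scont_bounded:
  assumes "scont (SFT N H) (f :: seq \<Rightarrow> real^'d^'d)"
  shows "\<exists>B. \<forall>x\<in>SFT N H. norm (f x) \<le> B"
proof -
  have "\<forall>x\<in>SFT N H. \<exists>K. \<forall>y\<in>SFT N H. agree K y x \<longrightarrow> mnorm (f y - f x) < 1"
    using scont_agree[OF assms] by simp
  from bchoice[OF this] obtain K where K: "\<forall>x\<in>SFT N H. \<forall>y\<in>SFT N H. agree (K x) y x \<longrightarrow> mnorm (f y - f x) < 1" ..
  obtain F where F: "F \<subseteq> SFT N H" "finite F" "SFT N H \<subseteq> (\<Union>x\<in>F. {y. agree (K x) y x})"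
    by (rule compactE_image[OF compact_SFT[of N H], of "SFT N H" "\<lambda>x. {y. agree (K x) y x}"])
      (auto simp: open_agree)
  let ?D = "real (CARD('d) * CARD('d))"
  have "norm (f y) \<le> (\<Sum>x\<in>F. norm (f x)) + ?D" if y: "y \<in> SFT N H" for y
  proof -
    obtain x where x: "x \<in> F" "agree (K x) y x" using F(3) y by blast
    have "mnorm (f y - f x) < 1" using K x F(1) y by blast
    then have "?D * mnorm (f y - f x) \<le> ?D * 1" by (intro mult_left_mono) auto
    then have "norm (f y - f x) \<le> ?D" using norm_le_mnorm[of "f y - f x"] by linarith
    moreover have "norm (f x) \<le> (\<Sum>x\<in>F. norm (f x))" using x F(2) by (intro member_le_sum) auto
    moreover have "norm (f y) \<le> norm (f y - f x) + norm (f x)"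
      using norm_triangle_ineq[of "f y - f x" "f x"] by simp
    ultimately show ?thesis by linarith
  qed
  then show ?thesis by blast
qed

lemma mnorm_diff_le_dC0:
  assumes f: "scont (SFT N H) f" and g: "scont (SFT N H) g" and x: "x \<in> SFT N H"
  shows "mnorm (f x - g x) \<le> dC0 (SFT N H) f g"
proof -
  obtain B B' where B: "\<forall>x\<in>SFT N H. norm (f x) \<le> B" "\<forall>x\<in>SFT N H. norm (g x) \<le> B'"
    using scont_bounded[OF f] scont_bounded[OF g] by blast
  have "mnorm (f y - g y) \<le> B + B'" if "y \<in> SFT N H" for y
  proof -
    have "mnorm (f y - g y) \<le> norm (f y) + norm (g y)"
      using order_trans[OF mnorm_le_norm norm_triangle_ineq4] .
    then show ?thesis using B that by fastforce
  qed
  then have "bdd_above ((\<lambda>x. mnorm (f x - g x)) ` SFT N H)" by (rule bdd_aboveI2)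
  then show ?thesis unfolding dC0_def using x by (intro cSUP_upper)
qed

section \<open>Bounded points of the approximating cocycles\<close>

lemma cocp_invertible:
  assumes "GL_cocycle (SFT N H) B" "x \<in> SFT N H"
  shows "invertible (cocp B n x)"
proof (induction n)
  case 0
  show ?case unfolding invertible_def by (auto intro!: exI[of _ "mat 1"])
next
  case (Suc n)
  then show ?case using assms SFT_shiftn by (auto simp: GL_cocycle_def intro!: invertible_mult)
qed

lemma Bset_quasi_isom:
  assumes B: "GL_cocycle (SFT N H) B" and x: "x \<in> Bset (SFT N H) B \<kappa>"
  shows "quasi_isom \<kappa> (cocp B n x)"
proof -
  let ?M = "cocp B n x"
  have xX: "x \<in> SFT N H" using x by (simp add: Bset_def)
  have "mnorm (coc B (int n) x) \<le> \<kappa> \<and> mnorm (matrix_inv (coc B (int n) x)) \<le> \<kappa>"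
    using x unfolding Bset_def by blast
  then have m: "mnorm ?M \<le> \<kappa>" "mnorm (matrix_inv ?M) \<le> \<kappa>" by (simp_all add: coc_def)
  have inv: "matrix_inv ?M ** ?M = mat 1"
    using cocp_invertible[OF B xX] someI_ex[of "\<lambda>M'. ?M ** M' = mat 1 \<and> M' ** ?M = mat 1"]
    by (simp add: invertible_def matrix_inv_def)
  have "norm (M' *v v) \<le> \<kappa> * norm v" if "mnorm M' \<le> \<kappa>" for M' and v :: "real^'a"
    using order_trans[OF norm_matrix_vector_le_mnorm mult_right_mono[OF that]] by simp
  note * = this[OF m(1)] this[OF m(2)]
  have "norm v \<le> \<kappa> * norm (?M *v v)" for v
    using *(2)[of "?M *v v"] inv by (simp add: matrix_vector_mul_assoc)
  then show ?thesis using *(1) by (simp add: quasi_isom_def)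
qed

text \<open>The product from time \<open>m\<close> on is the product up to \<open>n + m\<close>
  times the inverse of the product up to \<open>m\<close>, and each is controlled by
  \<open>\<kappa>\<close>.\<close>

lemma Bset_shift_quasi_isom:
  assumes B: "GL_cocycle (SFT N H) B" and x: "x \<in> Bset (SFT N H) B \<kappa>" and \<kappa>: "\<kappa> > 0"
  shows "quasi_isom (\<kappa>\<^sup>2) (cocp B n (shiftn (int m) x))"
proof -
  let ?M0 = "cocp B m x" and ?M1 = "cocp B n (shiftn (int m) x)" and ?M2 = "cocp B (n + m) x"
  have M0: "quasi_isom \<kappa> ?M0" and M2: "quasi_isom \<kappa> ?M2" using Bset_quasi_isom[OF B x] by auto
  obtain M' where M': "?M0 ** M' = mat 1" "op_bound M' \<kappa>" using quasi_isom_inverse[OF M0] by metis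
  have eq: "?M1 *v v = ?M2 *v (M' *v v)" for v
    using M'(1) by (simp add: cocp_add matrix_vector_mul_assoc matrix_mul_assoc[symmetric])
  show ?thesis
    unfolding quasi_isom_def
  proof (intro allI conjI)
    fix v
    have "norm (?M1 *v v) \<le> \<kappa> * norm (M' *v v)" using M2 by (simp add: eq quasi_isom_def)
    also have "\<dots> \<le> \<kappa> * (\<kappa> * norm v)" using M'(2) \<kappa> by (intro mult_left_mono) (auto simp: op_bound_def)
    finally show "norm (?M1 *v v) \<le> \<kappa>\<^sup>2 * norm v" by (simp add: power2_eq_square)
    have "norm v = norm (?M0 *v (M' *v v))" by (simp add: matrix_vector_mul_assoc M'(1))
    also have "\<dots> \<le> \<kappa> * norm (M' *v v)" using M0 by (simp add: quasi_isom_def)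
    also have "\<dots> \<le> \<kappa> * (\<kappa> * norm (?M1 *v v))"
      using M2 \<kappa> unfolding eq by (intro mult_left_mono) (auto simp: quasi_isom_def)
    finally show "norm v \<le> \<kappa>\<^sup>2 * norm (?M1 *v v)" by (simp add: power2_eq_square)
  qed
qed

text \<open>By the entropy gap, bounded points of \<open>An n\<close> with \<open>n\<close> large
  cannot avoid the cylinder around \<open>y\<close>. This gives points tending to \<open>y\<close>
  with bounded products; for fixed \<open>k\<close> these products converge to
  \<open>cocp A k y\<close>, and the bound is closed.\<close>

lemma uniformly_bounded_limit:
  fixes A :: "seq \<Rightarrow> real^'d^'d" and An :: "nat \<Rightarrow> seq \<Rightarrow> real^'d^'d"
  assumes trans: "transitive_shift (SFT N H)" and pos: "htop (SFT N H) > 0"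
    and A: "GL_cocycle (SFT N H) A" and An: "\<And>n. GL_cocycle (SFT N H) (An n)"
    and conv: "(\<lambda>n. dC0 (SFT N H) A (An n)) \<longlonglongrightarrow> 0" and \<kappa>: "\<kappa> > 0"
    and ent: "(\<lambda>n. htop (Bset (SFT N H) (An n) \<kappa>)) \<longlonglongrightarrow> htop (SFT N H)"
    and y: "y \<in> SFT N H"
  shows "quasi_isom (\<kappa>\<^sup>2) (cocp A k y)"
proof -
  have "\<exists>n\<ge>K. \<exists>z\<in>SFT N H. agree K z y \<and> (\<forall>k. quasi_isom (\<kappa>\<^sup>2) (cocp (An n) k z))" for K
  proof -
    obtain c where c: "ereal c < htop (SFT N H)"
      "\<And>Y. Y \<subseteq> SFT N H \<Longrightarrow> \<forall>x\<in>Y. \<forall>n::nat. \<not> agree K (shiftn (int n) x) y \<Longrightarrow> htop Y \<le> ereal c"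
      using htop_avoiding_less[OF trans y pos, of K] by blast
    \<comment> \<open>Asking for \<open>K \<le> n\<close> as well lets the cocycles tend to
      \<open>A\<close> while the points tend to \<open>y\<close>.\<close>
    have "\<forall>\<^sub>F n in sequentially. ereal c < htop (Bset (SFT N H) (An n) \<kappa>) \<and> K \<le> n"
      using order_tendstoD(1)[OF ent c(1)] eventually_ge_at_top by (rule eventually_conj)
    then obtain n where n: "ereal c < htop (Bset (SFT N H) (An n) \<kappa>)" "K \<le> n"
      using eventually_happens'[OF sequentially_bot] by blast
    have sub: "Bset (SFT N H) (An n) \<kappa> \<subseteq> SFT N H" by (auto simp: Bset_def)
    obtain x m where x: "x \<in> Bset (SFT N H) (An n) \<kappa>" "agree K (shiftn (int m) x) y"
      using c(2)[OF sub] n(1) by (meson not_le)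
    show ?thesis
      using n(2) x sub SFT_shiftn Bset_shift_quasi_isom[OF An x(1) \<kappa>] by blast
  qed
  then obtain n z where n: "\<And>K. n K \<ge> K" and z: "\<And>K. z K \<in> SFT N H" "\<And>K. agree K (z K) y"
    "\<And>K k. quasi_isom (\<kappa>\<^sup>2) (cocp (An (n K)) k (z K))" by metis
  let ?D = "real (CARD('d) * CARD('d))"
  have sA: "scont (SFT N H) A" and sAn: "\<And>n. scont (SFT N H) (An n)" using A An by (auto simp: GL_cocycle_def)
  have n_top: "filterlim n at_top sequentially"
    using n by (intro filterlim_at_top_mono[OF filterlim_ident]) auto
  have step: "(\<lambda>K. An (n K) (shiftn (int j) (z K))) \<longlonglongrightarrow> A (shiftn (int j) y)" for j
  proof -
    have "(\<lambda>K. A (shiftn (int j) (z K)) - A (shiftn (int j) y)) \<longlonglongrightarrow> 0"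
    proof (rule LIMSEQ_I)
      fix e :: real assume e: "e > 0"
      have e': "e / ?D > 0" using e by simp
      obtain K0 where K0: "\<And>x. x \<in> SFT N H \<Longrightarrow> agree K0 x (shiftn (int j) y) \<Longrightarrow> mnorm (A x - A (shiftn (int j) y)) < e / ?D"
        using scont_agree[OF sA SFT_shiftn[OF y] e'] by blast
      have "norm (A (shiftn (int j) (z K)) - A (shiftn (int j) y)) < e" if "K \<ge> K0 + j" for K
      proof -
        have "agree K0 (shiftn (int j) (z K)) (shiftn (int j) y)"
          using agree_mono[OF z(2) that] by (rule agree_shiftn)
        then have "mnorm (A (shiftn (int j) (z K)) - A (shiftn (int j) y)) < e / ?D"
          using K0 SFT_shiftn[OF z(1)] by blast
        then have "?D * mnorm (A (shiftn (int j) (z K)) - A (shiftn (int j) y)) < ?D * (e / ?D)"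
          by (intro mult_strict_left_mono) auto
        also have "\<dots> = e" by simp
        finally show ?thesis using norm_le_mnorm[of "A (shiftn (int j) (z K)) - A (shiftn (int j) y)"] by linarith
      qed
      then show "\<exists>no. \<forall>K\<ge>no. norm (A (shiftn (int j) (z K)) - A (shiftn (int j) y) - 0) < e" by auto
    qed
    moreover have "(\<lambda>K. A (shiftn (int j) (z K)) - An (n K) (shiftn (int j) (z K))) \<longlonglongrightarrow> 0"
    proof (rule Lim_null_comparison)
      show "\<forall>\<^sub>F K in sequentially. norm (A (shiftn (int j) (z K)) - An (n K) (shiftn (int j) (z K)))
          \<le> ?D * dC0 (SFT N H) A (An (n K))"
        by (intro always_eventually allI order_trans[OF norm_le_mnorm] mult_left_mono
            mnorm_diff_le_dC0 sA sAn SFT_shiftn z) auto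
      have "(\<lambda>K. dC0 (SFT N H) A (An (n K))) \<longlonglongrightarrow> 0" by (rule filterlim_compose[OF conv n_top])
      from tendsto_mult_right_zero[OF this, of ?D]
      show "(\<lambda>K. ?D * dC0 (SFT N H) A (An (n K))) \<longlonglongrightarrow> 0" .
    qed
    ultimately have "(\<lambda>K. (A (shiftn (int j) (z K)) - A (shiftn (int j) y))
       - (A (shiftn (int j) (z K)) - An (n K) (shiftn (int j) (z K)))) \<longlonglongrightarrow> 0 - 0" by (rule tendsto_diff)
    then have "(\<lambda>K. An (n K) (shiftn (int j) (z K)) - A (shiftn (int j) y)) \<longlonglongrightarrow> 0" by simp
    then show ?thesis by (rule LIM_zero_cancel)
  qed
  have "(\<lambda>K. cocp (An (n K)) k (z K)) \<longlonglongrightarrow> cocp A k y"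
    by (induction k) (auto intro!: tendsto_matrix_mult step)
  then have "cocp A k y \<in> {M. quasi_isom (\<kappa>\<^sup>2) M}"
    by (rule closed_sequentially[OF closed_quasi_isom, rotated]) (simp add: z(3))
  then show ?thesis by simp
qed

lemma quasi_isom_mono: "quasi_isom \<kappa> M \<Longrightarrow> \<kappa> \<le> \<kappa>' \<Longrightarrow> quasi_isom \<kappa>' M"
  unfolding quasi_isom_def by (meson mult_right_mono norm_ge_zero order_trans)

proposition conj_isometric_limit:
  fixes A :: "seq \<Rightarrow> real^'d^'d" and An :: "nat \<Rightarrow> seq \<Rightarrow> real^'d^'d"
  assumes \<alpha>: "\<alpha> > 0" and trans: "transitive_shift (SFT N H)" and pos: "htop (SFT N H) > 0"
    and A: "GL_cocycle (SFT N H) A" and hol: "holder (SFT N H) \<alpha> A"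
    and An: "\<And>n. GL_cocycle (SFT N H) (An n)"
    and conv: "(\<lambda>n. dC0 (SFT N H) A (An n)) \<longlonglongrightarrow> 0" and \<kappa>: "\<kappa> > 0"
    and ent: "(\<lambda>n. htop (Bset (SFT N H) (An n) \<kappa>)) \<longlonglongrightarrow> htop (SFT N H)"
  shows "conj_isometric (SFT N H) A"
proof -
  obtain C where C: "\<forall>x\<in>SFT N H. \<forall>y\<in>SFT N H. mnorm (A x - A y) \<le> C * sdist x y powr \<alpha>"
    using hol unfolding holder_def by blast
  let ?D = "real (CARD('d) * CARD('d))"
  \<comment> \<open>\<open>max 1\<close> meets the requirement of a bound at least 1, the absolute
    value covers a negative Hoelder constant, and \<open>?D\<close> passes from the operator norm to
    the Euclidean one.\<close>
  interpret bounded_cocycle N H A "max 1 (\<kappa>\<^sup>2)" \<alpha> "?D * \<bar>C\<bar>"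
  proof
    fix x y assume x: "x \<in> SFT N H" and y: "y \<in> SFT N H"
    have "norm (A x - A y) \<le> ?D * mnorm (A x - A y)" by (rule norm_le_mnorm)
    also have "\<dots> \<le> ?D * (C * sdist x y powr \<alpha>)" using C x y by (intro mult_left_mono) auto
    also have "\<dots> \<le> ?D * (\<bar>C\<bar> * sdist x y powr \<alpha>)" by (intro mult_left_mono mult_right_mono) auto
    finally show "norm (A x - A y) \<le> ?D * \<bar>C\<bar> * sdist x y powr \<alpha>" by (simp add: mult.assoc)
  next
    fix x n assume x: "x \<in> SFT N H"
    show "quasi_isom (max 1 (\<kappa>\<^sup>2)) (cocp A n x)"
      using uniformly_bounded_limit[OF trans pos A An conv \<kappa> ent x] by (rule quasi_isom_mono) simp
  qed (use \<alpha> trans in auto)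
  show ?thesis by (rule conj_isometric)
qed

theorem theoremD:
  fixes N :: nat and H :: "nat \<Rightarrow> nat \<Rightarrow> bool" and \<alpha> :: real
    and A :: "seq \<Rightarrow> real^'d^'d"
  assumes "\<alpha> > 0"
    and "transitive_shift (SFT N H)"
    and "htop (SFT N H) > 0"
    and "GL_cocycle (SFT N H) A"
    and "holder (SFT N H) \<alpha> A"
  shows "(\<forall>An :: nat \<Rightarrow> seq \<Rightarrow> real^'d^'d. \<forall>\<kappa>>0.
            (\<forall>n. GL_cocycle (SFT N H) (An n)) \<longrightarrow>
            (\<lambda>n. dC0 (SFT N H) A (An n)) \<longlonglongrightarrow> 0 \<longrightarrow>
            (\<lambda>n. htop (Bset (SFT N H) (An n) \<kappa>)) \<longlonglongrightarrow> htop (SFT N H) \<longrightarrow>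
            conj_isometric (SFT N H) A)
       \<and> (\<forall>\<kappa>>0. htop (Bset (SFT N H) A \<kappa>) = htop (SFT N H) \<longrightarrow> conj_isometric (SFT N H) A)"
proof (intro conjI allI impI)
  show "conj_isometric (SFT N H) A"
    if "\<kappa> > 0" "\<forall>n. GL_cocycle (SFT N H) (An n)" "(\<lambda>n. dC0 (SFT N H) A (An n)) \<longlonglongrightarrow> 0"
      "(\<lambda>n. htop (Bset (SFT N H) (An n) \<kappa>)) \<longlonglongrightarrow> htop (SFT N H)"
    for An :: "nat \<Rightarrow> seq \<Rightarrow> real^'d^'d" and \<kappa>
    using conj_isometric_limit[OF assms, of An \<kappa>] that by blast
  show "conj_isometric (SFT N H) A"
    if "\<kappa> > 0" "htop (Bset (SFT N H) A \<kappa>) = htop (SFT N H)" for \<kappa>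
  proof -
    \<comment> \<open>The constant sequence \<open>A\<close> is used; evaluating \<open>dC0\<close>
      at equal arguments needs a supremum over a nonempty set.\<close>
    have "SFT N H \<noteq> {}" using assms(2) by (auto simp: transitive_shift_def)
    moreover have "mnorm (0 :: real^'d^'d) = 0" by (simp add: mnorm_def onorm_zero)
    ultimately have "dC0 (SFT N H) A A = 0" by (simp add: dC0_def)
    then show ?thesis
      using conj_isometric_limit[OF assms, of "\<lambda>_. A" \<kappa>] assms(4) that by simp
  qed
qed

end
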